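(* Fix a real number $p \ge 1$ and a constant $\varepsilon > 0$. Suppose that, for some number of deadlines $k = O(1+\varepsilon^{-2})$ of our choice, $\mathcal{A}$ is an $\alpha$-approximation algorithm for segmented-TSP with $k$ deadlines. Then there is a $(1+\varepsilon)\cdot\alpha$-approximation algorithm for $L_p$-TSP which calls $\mathcal{A}$ (always on the same network $(V,s,d)$ as the $L_p$-TSP input) a strongly polynomial number of times.
   Context: An instance consists of a finite set $V$ with $|V| = n$, a starting vertex $s \in V$, and a metric $d: V\times V \to \mathbb{R}_{\ge 0}$ (symmetric, $d(x,x)=0$, triangle inequality). A feasible route is a permutation $\sigma = (\sigma_1,\dots,\sigma_n)$ of $V$ with $\sigma_1 = s$; a traveler of unit speed follows it, so the visit time of $v = \sigma_i$ is $\ell^\sigma_v = \sum_{j=2}^{i} d(\sigma_{j-1},\sigma_j)$ (and $\ell^\sigma_s = 0$). $L_p$-TSP: find a feasible route minimizing $\|\ell^\sigma\|_p = (\sum_{v\in V} |\ell^\sigma_v|^p)^{1/p}$; a $\beta$-approximation algorithm outputs a feasible route whose objective is at most $\beta$ times the optimum. Segmented-TSP with $k$ deadlines: given $(V,s,d)$, integers $n_1 \le \dots \le n_k \le n$ and reals $t_1 \le \dots \le t_k$, decide whether there is a route starting at $s$ that visits at least $n_i$ distinct vertices by time $t_i$ for every $i \in [k]$. An $\alpha$-approximate solution to a segmented-TSP instance is a route visiting at least $n_i$ vertices by time $\alpha\cdot t_i$ for all $i\in[k]$, which must be produced whenever the original segmented-TSP instance is feasible. *)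

theory Defs
  imports Complex_Main
begin

text \<open>
  Since networks are inputs of programs, the \<open>n\<close> vertices are numbered \<open>0, \<dots>, n - 1\<close>.
  Values of \<open>travel\<close> outside of this range are irrelevant.
\<close>

record network =
  nverts :: nat
  source :: nat
  travel :: "nat \<Rightarrow> nat \<Rightarrow> real"

definition verts :: "network \<Rightarrow> nat set" where
  "verts N = {..<nverts N}"

text \<open>Distinct vertices may be at distance zero.\<close>

definition metric_network :: "network \<Rightarrow> bool" where
  "metric_network N \<longleftrightarrow>
     source N \<in> verts N \<and>
     (\<forall>x\<in>verts N. travel N x x = 0) \<and>
     (\<forall>x\<in>verts N. \<forall>y\<in>verts N. 0 \<le> travel N x y \<and> travel N x y = travel N y x) \<and>
     (\<forall>x\<in>verts N. \<forall>y\<in>verts N. \<forall>z\<in>verts N. travel N x z \<le> travel N x y + travel N y z)"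

text \<open>A route may revisit vertices and need not visit all of them.\<close>

definition route :: "network \<Rightarrow> nat list \<Rightarrow> bool" where
  "route N xs \<longleftrightarrow> xs \<noteq> [] \<and> hd xs = source N \<and> set xs \<subseteq> verts N"

definition feasible_route :: "network \<Rightarrow> nat list \<Rightarrow> bool" where
  "feasible_route N xs \<longleftrightarrow> route N xs \<and> distinct xs \<and> set xs = verts N"

definition arrival :: "network \<Rightarrow> nat list \<Rightarrow> nat \<Rightarrow> real" where
  "arrival N xs i = (\<Sum>j<i. travel N (xs ! j) (xs ! Suc j))"


section \<open>\<open>L\<^sub>p\<close>-TSP\<close>

definition visit_time :: "network \<Rightarrow> nat list \<Rightarrow> nat \<Rightarrow> real" where
  "visit_time N xs v = arrival N xs (LEAST i. i < length xs \<and> xs ! i = v)"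

definition lp_objective :: "real \<Rightarrow> network \<Rightarrow> nat list \<Rightarrow> real" where
  "lp_objective p N xs = (\<Sum>v\<in>verts N. \<bar>visit_time N xs v\<bar> powr p) powr (1 / p)"

definition lp_opt :: "real \<Rightarrow> network \<Rightarrow> real" where
  "lp_opt p N = Min (lp_objective p N ` {xs. feasible_route N xs})"


section \<open>Segmented-TSP\<close>

definition visited_by :: "network \<Rightarrow> nat list \<Rightarrow> real \<Rightarrow> nat set" where
  "visited_by N xs t = {xs ! i | i. i < length xs \<and> arrival N xs i \<le> t}"

definition seg_instance :: "network \<Rightarrow> nat \<Rightarrow> nat list \<Rightarrow> real list \<Rightarrow> bool" where
  "seg_instance N k ns ts \<longleftrightarrow>
     length ns = k \<and> length ts = k \<and> sorted ns \<and> sorted ts \<and> (\<forall>m\<in>set ns. m \<le> nverts N)"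

definition seg_solution :: "real \<Rightarrow> network \<Rightarrow> nat list \<Rightarrow> real list \<Rightarrow> nat list \<Rightarrow> bool" where
  "seg_solution \<alpha> N ns ts xs \<longleftrightarrow>
     route N xs \<and> (\<forall>i<length ns. ns ! i \<le> card (visited_by N xs (\<alpha> * ts ! i)))"

definition seg_feasible :: "network \<Rightarrow> nat list \<Rightarrow> real list \<Rightarrow> bool" where
  "seg_feasible N ns ts \<longleftrightarrow> (\<exists>xs. seg_solution 1 N ns ts xs)"

text \<open>
  An algorithm for segmented-TSP is only used as a black box, hence it is represented by its
  input-output function. Its answer on infeasible instances is unconstrained; it may be \<open>[]\<close>
  to report infeasibility, but it may just as well be an arbitrary list.
\<close>

type_synonym seg_alg = "network \<Rightarrow> nat list \<Rightarrow> real list \<Rightarrow> nat list"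

definition seg_approx_algorithm :: "real \<Rightarrow> nat \<Rightarrow> seg_alg \<Rightarrow> bool" where
  "seg_approx_algorithm \<alpha> k A \<longleftrightarrow>
     (\<forall>N ns ts. metric_network N \<longrightarrow> seg_instance N k ns ts \<longrightarrow> seg_feasible N ns ts \<longrightarrow>
        seg_solution \<alpha> N ns ts (A N ns ts))"


section \<open>Programs with access to a segmented-TSP algorithm\<close>

text \<open>
  The model of computation is a real RAM, presented as a while language with variables and
  (unbounded) arrays over \<open>nat\<close> and over \<open>real\<close>.

  \<^item> The only operations on \<open>nat\<close> are addition and truncated subtraction. Unit-cost
    multiplication together with division would make polynomial time too powerful.
  \<^item> On \<open>real\<close> there are the field operations, comparison, and \<open>x \<mapsto> |x|\<^sup>p\<close> for the \<open>p\<close> of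
    the objective function. There is no rounding to \<open>nat\<close>, and the only literals are
    natural numbers, so that no information can be hidden in real constants.
  \<^item> The network can only be inspected through \<open>Dist\<close>, and by \<open>Call\<close>.
\<close>

type_synonym vname = string

datatype nexp =
    Num nat
  | NVar vname
  | NArr vname nexp
  | NPlus nexp nexp
  | NMinus nexp nexp

datatype rexp =
    OfNat nexp
  | RVar vname
  | RArr vname nexp
  | Dist nexp nexp
  | RPlus rexp rexp
  | RMinus rexp rexp
  | RTimes rexp rexp
  | RDivide rexp rexp
  | PowP rexp

datatype bexp =
    NLess nexp nexp
  | RLess rexp rexp
  | Neg bexp
  | Conj bexp bexp

text \<open>
  \<open>Call a b c x\<close> passes the first \<open>k\<close> entries of the arrays \<open>a\<close> (over \<open>nat\<close>) and \<open>b\<close>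
  (over \<open>real\<close>) to the segmented-TSP algorithm, along with the input network itself; the answer
  is stored in the array \<open>c\<close>, its length in the variable \<open>x\<close>.
\<close>

datatype com =
    Skip
  | NAssign vname nexp
  | RAssign vname rexp
  | NUpdate vname nexp nexp
  | RUpdate vname nexp rexp
  | Seq com com
  | If bexp com com
  | While bexp com
  | Call vname vname vname vname

record state =
  nvar :: "vname \<Rightarrow> nat"
  rvar :: "vname \<Rightarrow> real"
  narr :: "vname \<Rightarrow> nat \<Rightarrow> nat"
  rarr :: "vname \<Rightarrow> nat \<Rightarrow> real"

fun nval :: "nexp \<Rightarrow> state \<Rightarrow> nat" where
  "nval (Num m) s = m"
| "nval (NVar x) s = nvar s x"
| "nval (NArr a e) s = narr s a (nval e s)"
| "nval (NPlus e f) s = nval e s + nval f s"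
| "nval (NMinus e f) s = nval e s - nval f s"

fun rval :: "real \<Rightarrow> network \<Rightarrow> rexp \<Rightarrow> state \<Rightarrow> real" where
  "rval p N (OfNat e) s = real (nval e s)"
| "rval p N (RVar x) s = rvar s x"
| "rval p N (RArr a e) s = rarr s a (nval e s)"
| "rval p N (Dist e f) s = travel N (nval e s) (nval f s)"
| "rval p N (RPlus e f) s = rval p N e s + rval p N f s"
| "rval p N (RMinus e f) s = rval p N e s - rval p N f s"
| "rval p N (RTimes e f) s = rval p N e s * rval p N f s"
| "rval p N (RDivide e f) s = rval p N e s / rval p N f s"
| "rval p N (PowP e) s = \<bar>rval p N e s\<bar> powr p"

fun bval :: "real \<Rightarrow> network \<Rightarrow> bexp \<Rightarrow> state \<Rightarrow> bool" where
  "bval p N (NLess e f) s \<longleftrightarrow> nval e s < nval f s"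
| "bval p N (RLess e f) s \<longleftrightarrow> rval p N e s < rval p N f s"
| "bval p N (Neg b) s \<longleftrightarrow> \<not> bval p N b s"
| "bval p N (Conj b c) s \<longleftrightarrow> bval p N b s \<and> bval p N c s"

text \<open>
  \<open>exec p k A N c s t m rs\<close>: started in state \<open>s\<close>, the program \<open>c\<close> terminates in state \<open>t\<close>
  after \<open>m\<close> steps, having received the list \<open>rs\<close> of answers from \<open>A\<close>. Every assignment, test
  and call is one step, as the expressions in a fixed program have constant size. A call is
  stuck unless its arguments form a segmented-TSP instance with \<open>k\<close> deadlines.
\<close>

inductive exec :: "real \<Rightarrow> nat \<Rightarrow> seg_alg \<Rightarrow> network \<Rightarrow>
    com \<Rightarrow> state \<Rightarrow> state \<Rightarrow> nat \<Rightarrow> nat list list \<Rightarrow> bool"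
  for p k A N where
  Skip: "exec p k A N Skip s s 1 []"
| NAssign: "exec p k A N (NAssign x e) s (s\<lparr>nvar := (nvar s)(x := nval e s)\<rparr>) 1 []"
| RAssign: "exec p k A N (RAssign x e) s (s\<lparr>rvar := (rvar s)(x := rval p N e s)\<rparr>) 1 []"
| NUpdate: "exec p k A N (NUpdate a i e) s
    (s\<lparr>narr := (narr s)(a := (narr s a)(nval i s := nval e s))\<rparr>) 1 []"
| RUpdate: "exec p k A N (RUpdate a i e) s
    (s\<lparr>rarr := (rarr s)(a := (rarr s a)(nval i s := rval p N e s))\<rparr>) 1 []"
| Seq: "exec p k A N c s s' m rs \<Longrightarrow> exec p k A N c' s' t m' rs' \<Longrightarrow>
    exec p k A N (Seq c c') s t (m + m') (rs @ rs')"
| IfTrue: "bval p N b s \<Longrightarrow> exec p k A N c s t m rs \<Longrightarrow>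
    exec p k A N (If b c c') s t (Suc m) rs"
| IfFalse: "\<not> bval p N b s \<Longrightarrow> exec p k A N c' s t m rs \<Longrightarrow>
    exec p k A N (If b c c') s t (Suc m) rs"
| WhileFalse: "\<not> bval p N b s \<Longrightarrow> exec p k A N (While b c) s s 1 []"
| WhileTrue: "bval p N b s \<Longrightarrow> exec p k A N c s s' m rs \<Longrightarrow>
    exec p k A N (While b c) s' t m' rs' \<Longrightarrow>
    exec p k A N (While b c) s t (Suc (m + m')) (rs @ rs')"
| Call: "ns = map (narr s a) [0..<k] \<Longrightarrow> ts = map (rarr s b) [0..<k] \<Longrightarrow>
    seg_instance N k ns ts \<Longrightarrow> xs = A N ns ts \<Longrightarrow>
    exec p k A N (Call a b c x) s
      (s\<lparr>nvar := (nvar s)(x := length xs),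
         narr := (narr s)(c := (\<lambda>i. if i < length xs then xs ! i else narr s c i))\<rparr>) 1 [xs]"

inductive_cases SkipE: "exec p k A N Skip s t m rs"
inductive_cases NAssignE: "exec p k A N (NAssign x e) s t m rs"
inductive_cases RAssignE: "exec p k A N (RAssign x e) s t m rs"
inductive_cases NUpdateE: "exec p k A N (NUpdate a i e) s t m rs"
inductive_cases RUpdateE: "exec p k A N (RUpdate a i e) s t m rs"
inductive_cases SeqE: "exec p k A N (Seq c c') s t m rs"
inductive_cases IfE: "exec p k A N (If b c c') s t m rs"
inductive_cases WhileE: "exec p k A N (While b c) s t m rs"
inductive_cases CallE: "exec p k A N (Call a b c x) s t m rs"

lemma exec_deterministic:
  assumes "exec p k A N c s t m rs" and "exec p k A N c s t' m' rs'"
  shows "t' = t \<and> m' = m \<and> rs' = rs"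
  using assms
proof (induction arbitrary: t' m' rs' rule: exec.induct)
  case (Seq c s s' m rs c' t m1 rs1)
  from Seq.prems show ?case
  proof (rule SeqE)
    fix u n qs v n' qs'
    assume *: "m' = n + n'" "rs' = qs @ qs'" "exec p k A N c s u n qs" "exec p k A N c' u t' n' qs'"
    with Seq.IH(1) have "u = s'" "n = m" "qs = rs" by blast+
    with * Seq.IH(2) show ?thesis by blast
  qed
next
  case (IfTrue b s c t m rs c')
  from IfTrue.prems show ?case
    by (rule IfE) (use IfTrue.IH IfTrue.hyps in blast)+
next
  case (IfFalse b s c' t m rs c)
  from IfFalse.prems show ?case
    by (rule IfE) (use IfFalse.IH IfFalse.hyps in blast)+
next
  case (WhileFalse b s c)
  from WhileFalse.prems show ?case
    by (rule WhileE) (use WhileFalse.hyps in auto)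
next
  case (WhileTrue b s c s' m rs t m1 rs1)
  from WhileTrue.prems show ?case
  proof (rule WhileE)
    fix u n qs n' qs'
    assume *: "m' = Suc (n + n')" "rs' = qs @ qs'" "exec p k A N c s u n qs"
      "exec p k A N (While b c) u t' n' qs'"
    with WhileTrue.IH(1) have "u = s'" "n = m" "qs = rs" by blast+
    with * WhileTrue.IH(2) show ?thesis by blast
  qed (use WhileTrue.hyps in blast)
next
  case (Call ns s a ts b xs c x)
  from Call.prems show ?case by (rule CallE) (use Call.hyps in auto)
qed (erule SkipE NAssignE RAssignE NUpdateE RUpdateE, simp)+

definition initial_state :: "network \<Rightarrow> state" where
  "initial_state N = \<lparr>nvar = (\<lambda>_. 0)(''n'' := nverts N, ''s'' := source N), rvar = (\<lambda>_. 0),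
              narr = (\<lambda>_ _. 0), rarr = (\<lambda>_ _. 0)\<rparr>"

definition result :: "network \<Rightarrow> state \<Rightarrow> nat list" where
  "result N t = map (narr t ''out'') [0..<nverts N]"

definition lp_approx_algorithm :: "real \<Rightarrow> nat \<Rightarrow> seg_alg \<Rightarrow> real \<Rightarrow> com \<Rightarrow> bool" where
  "lp_approx_algorithm p k A \<beta> P \<longleftrightarrow>
     (\<forall>N. metric_network N \<longrightarrow>
        (\<exists>t m rs. exec p k A N P (initial_state N) t m rs \<and>
           feasible_route N (result N t) \<and>
           lp_objective p N (result N t) \<le> \<beta> * lp_opt p N))"

definition strongly_polynomial_calls :: "real \<Rightarrow> nat \<Rightarrow> seg_alg \<Rightarrow> com \<Rightarrow> bool" where
  "strongly_polynomial_calls p k A P \<longleftrightarrow>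
     (\<exists>c. \<forall>N t m rs. metric_network N \<longrightarrow> exec p k A N P (initial_state N) t m rs \<longrightarrow>
        length rs \<le> c * nverts N ^ c)"

text \<open>
  Routes may be walks of any length, so the time is measured in terms of the number of vertices
  and the total length of the answers of \<open>A\<close>; the time spent inside of \<open>A\<close> does not count.
\<close>

definition strongly_polynomial_time :: "real \<Rightarrow> nat \<Rightarrow> seg_alg \<Rightarrow> com \<Rightarrow> bool" where
  "strongly_polynomial_time p k A P \<longleftrightarrow>
     (\<exists>c. \<forall>N t m rs. metric_network N \<longrightarrow> exec p k A N P (initial_state N) t m rs \<longrightarrow>
        m \<le> c * (nverts N + sum_list (map length rs)) ^ c)"

end

(*
  An optimal tour visits N(t) vertices by time t. Cut its time axis at the points q^G with
  G = theta (mod k), where q = 1 + 1/h. For a chunk (q^G, q^(G+k)], ask for N(t) vertices by time t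
  for the powers t of q in the chunk (K = k + 2 deadlines, so k = O(h^2) suffices). The answer starts
  from the source again and may revisit vertices, so it can be appended to any earlier answers after
  a return to the source: all visits of the chunk are then delayed by O(alpha q^G) only. Averaged over
  theta, this delay is a fraction O(1/(k (q - 1))) = O(1/h) of the visit time, also for p-th powers.

  The program need not know N: it guesses N at the deadlines and keeps, for every guess, the cheapest
  way to extend a partial route by the new vertices of the answer. The partial routes that may be
  extended have as many vertices as the chunk requires and end before beta T, for the scale T = q^G of
  the chunk. It is enough to know T up to a factor q; as q^G lies within a factor max(n, q^k) of some
  distance, the multiples T = d(x, y) i / M with i \<le> M n suffice, which makes the number of guesses
  strongly polynomial. All guesses are enumerated by a counter with K + 4 digits, in n rounds, because
  an optimal tour has at most n nonempty chunks.
*)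

theory Submission
  imports Defs "HOL-Analysis.Convex"
begin

section \<open>Weakest preconditions with running times\<close>

text \<open>The partial routes of the tour itself need not occur among the labels: an answer of
  \<open>A\<close> may visit other vertices than the tour, and the program may prefer another label.
  What carries over is a number of vertices, a bound on the end and a bound on the cost. This
  suffices: \<open>m\<close> distinct vertices seen by an answer leave the extended label with at
  least \<open>m\<close> vertices (up to the guessed total), and the estimate for appended vertices
  depends only on the length and the end bound of the label that they are appended to. Hence the
  cheapest such label is as good as any. The bound on the end has to reproduce itself from chunk to
  chunk. The return doubles it, but a chunk stretches time by a factor of at least 4; the new visits
  add at most \<open>4 * \<alpha>\<close> times the same power of \<open>q\<close>. This is solved
  by \<open>\<beta> \<ge> 8 * \<alpha>\<close>. Literals of programs are natural numbers, so
  \<open>q\<close> is a quotient of integers and \<open>\<beta>\<close> is an integer. Wrong guesses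
  are harmless: every label is a simple route with its true cost.\<close>

locale machine =
  fixes p :: real and K :: nat and A :: seg_alg and N :: network
begin

text \<open>Total correctness. Since \<open>exec\<close> is deterministic, the existing run is the
  only one, which makes the rules below equivalences that can serve as rewrite rules.\<close>

definition wp :: "com \<Rightarrow> (state \<Rightarrow> nat \<Rightarrow> nat list list \<Rightarrow> bool) \<Rightarrow> state \<Rightarrow> bool" where
  "wp c Q s \<longleftrightarrow> (\<exists>t m rs. exec p K A N c s t m rs \<and> Q t m rs)"

lemma wp_mono:
  assumes "wp c Q s" and "\<And>t m rs. Q t m rs \<Longrightarrow> Q' t m rs"
  shows "wp c Q' s"
  using assms unfolding wp_def by blast

lemma wp_eqI: "exec p K A N c s t m rs \<Longrightarrow> wp c Q s \<longleftrightarrow> Q t m rs"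
  unfolding wp_def using exec_deterministic by blast

lemma wp_Skip [simp]: "wp Skip Q s \<longleftrightarrow> Q s 1 []"
  by (rule wp_eqI) (rule exec.Skip)

lemma wp_NAssign [simp]:
  "wp (NAssign x e) Q s \<longleftrightarrow> Q (s\<lparr>nvar := (nvar s)(x := nval e s)\<rparr>) 1 []"
  by (rule wp_eqI) (rule exec.NAssign)

lemma wp_RAssign [simp]:
  "wp (RAssign x e) Q s \<longleftrightarrow> Q (s\<lparr>rvar := (rvar s)(x := rval p N e s)\<rparr>) 1 []"
  by (rule wp_eqI) (rule exec.RAssign)

lemma wp_NUpdate [simp]:
  "wp (NUpdate a i e) Q s \<longleftrightarrow>
     Q (s\<lparr>narr := (narr s)(a := (narr s a)(nval i s := nval e s))\<rparr>) 1 []"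
  by (rule wp_eqI) (rule exec.NUpdate)

lemma wp_RUpdate [simp]:
  "wp (RUpdate a i e) Q s \<longleftrightarrow>
     Q (s\<lparr>rarr := (rarr s)(a := (rarr s a)(nval i s := rval p N e s))\<rparr>) 1 []"
  by (rule wp_eqI) (rule exec.RUpdate)

lemma wp_Seq [simp]:
  "wp (Seq c c') Q s \<longleftrightarrow>
     wp c (\<lambda>t m rs. wp c' (\<lambda>t' m' rs'. Q t' (m + m') (rs @ rs')) t) s"
  unfolding wp_def
  by (rule iffI; (elim exE conjE SeqE)?) (blast intro: exec.intros)+

lemma wp_If [simp]:
  "wp (If b c c') Q s \<longleftrightarrow>
     (if bval p N b s then wp c (\<lambda>t m. Q t (Suc m)) s else wp c' (\<lambda>t m. Q t (Suc m)) s)"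
  unfolding wp_def by (auto elim!: IfE intro: exec.IfTrue exec.IfFalse)

abbreviation answered :: "nat list list \<Rightarrow> nat" where
  "answered rs \<equiv> sum_list (map length rs)"

text \<open>The number of iterations is fixed beforehand, so termination, calls and steps are
  handled along with the invariant. The term \<open>\<rho> * answered rs\<close> charges time to the
  entries of the answers, whose lengths no function of the network bounds.\<close>

lemma wp_While_for:
  assumes init: "I 0 s"
    and body: "\<And>i t. i < n \<Longrightarrow> I i t \<Longrightarrow> bval p N b t \<and>
      wp c (\<lambda>t' m rs. I (Suc i) t' \<and> length rs \<le> \<kappa> \<and> m \<le> \<tau> + \<rho> * answered rs) t"
    and exit: "\<And>t. I n t \<Longrightarrow> \<not> bval p N b t"
    and post: "\<And>t m rs. I n t \<Longrightarrow> length rs \<le> n * \<kappa> \<Longrightarrow>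
      m \<le> n * (\<tau> + 1) + 1 + \<rho> * answered rs \<Longrightarrow> Q t m rs"
  shows "wp (While b c) Q s"
proof -
  have "I i t \<Longrightarrow> i \<le> n \<Longrightarrow> \<exists>u m rs. exec p K A N (While b c) t u m rs \<and> I n u \<and>
      length rs \<le> (n - i) * \<kappa> \<and> m \<le> (n - i) * (\<tau> + 1) + 1 + \<rho> * answered rs" for i t
  proof (induction "n - i" arbitrary: i t)
    case 0
    then have "i = n" by simp
    with 0 exit show ?case by (fastforce intro: exec.WhileFalse)
  next
    case (Suc d)
    then have less: "i < n" and d: "d = n - Suc i" by simp_all
    from body[OF less Suc.prems(1)] obtain t' m rs where step: "bval p N b t"
      "exec p K A N c t t' m rs" "I (Suc i) t'" "length rs \<le> \<kappa>" "m \<le> \<tau> + \<rho> * answered rs"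
      unfolding wp_def by blast
    from Suc.hyps(1)[OF d step(3)] less obtain u m' rs' where rest:
      "exec p K A N (While b c) t' u m' rs'" "I n u" "length rs' \<le> (n - Suc i) * \<kappa>"
      "m' \<le> (n - Suc i) * (\<tau> + 1) + 1 + \<rho> * answered rs'" by auto
    have eq: "n - i = Suc (n - Suc i)" using less by simp
    show ?case
    proof (intro exI conjI)
      show "exec p K A N (While b c) t u (Suc (m + m')) (rs @ rs')"
        using step rest by (blast intro: exec.WhileTrue)
      show "length (rs @ rs') \<le> (n - i) * \<kappa>" using step rest unfolding eq by simp
      show "Suc (m + m') \<le> (n - i) * (\<tau> + 1) + 1 + \<rho> * answered (rs @ rs')"
        using step rest unfolding eq by (simp add: algebra_simps)
    qed (use rest in simp)
  qed
  from this[OF init] post show ?thesis unfolding wp_def by (metis diff_zero zero_le)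
qed

lemma wp_While_callfree:
  assumes "I 0 s"
    and "\<And>i t. i < n \<Longrightarrow> I i t \<Longrightarrow> bval p N b t \<and>
      wp c (\<lambda>t' m rs. I (Suc i) t' \<and> rs = [] \<and> m \<le> \<tau>) t"
    and "\<And>t. I n t \<Longrightarrow> \<not> bval p N b t"
    and "\<And>t m. I n t \<Longrightarrow> m \<le> n * (\<tau> + 1) + 1 \<Longrightarrow> Q t m []"
  shows "wp (While b c) Q s"
proof (rule wp_While_for[where I = I and n = n and \<kappa> = 0 and \<tau> = \<tau> and \<rho> = 0])
  show "bval p N b t \<and>
      wp c (\<lambda>t' m rs. I (Suc i) t' \<and> length rs \<le> 0 \<and> m \<le> \<tau> + 0 * answered rs) t"
    if "i < n" "I i t" for i t
    using assms(2)[OF that] by (auto elim: wp_mono)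
qed (use assms in auto)

end

section \<open>Routes and their extensions\<close>

lemma arrival_0 [simp]: "arrival N xs 0 = 0"
  by (simp add: arrival_def)

lemma arrival_Suc: "arrival N xs (Suc i) = arrival N xs i + travel N (xs ! i) (xs ! Suc i)"
  by (simp add: arrival_def)

lemma arrival_append: "i < length xs \<Longrightarrow> arrival N (xs @ ys) i = arrival N xs i"
  by (simp add: arrival_def nth_append)

locale metric =
  fixes N :: network
  assumes metric: "metric_network N"
begin

abbreviation "n \<equiv> nverts N"
abbreviation "d \<equiv> travel N"
abbreviation "arr \<equiv> arrival N"

lemma source_less: "source N < n"
  using metric by (simp add: metric_network_def verts_def)

lemma d_self: "x < n \<Longrightarrow> d x x = 0"
  and d_nonneg: "x < n \<Longrightarrow> y < n \<Longrightarrow> 0 \<le> d x y"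
  and d_commute: "x < n \<Longrightarrow> y < n \<Longrightarrow> d x y = d y x"
  and d_triangle: "x < n \<Longrightarrow> y < n \<Longrightarrow> z < n \<Longrightarrow> d x z \<le> d x y + d y z"
  using metric by (simp_all add: metric_network_def verts_def)

lemma route_nth_less: "route N xs \<Longrightarrow> i < length xs \<Longrightarrow> xs ! i < n"
  by (auto simp: route_def verts_def dest: nth_mem)

lemma route_nth_0: "route N xs \<Longrightarrow> xs ! 0 = source N"
  by (auto simp: route_def hd_conv_nth)

lemma arrival_mono:
  assumes "route N xs" "j < length xs" "i \<le> j"
  shows "arr xs i \<le> arr xs j"
  unfolding arrival_def
  by (rule sum_mono2) (use assms in \<open>auto intro!: d_nonneg route_nth_less\<close>)

lemma arrival_nonneg: "route N xs \<Longrightarrow> i < length xs \<Longrightarrow> 0 \<le> arr xs i"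
  using arrival_mono[of xs i 0] by simp

text \<open>Triangle inequality along the route. It bounds the return trip from the end of a label,
  and later the time needed to see a second vertex at all.\<close>

lemma travel_le_arrival:
  assumes "route N xs" "i < length xs"
  shows "d (source N) (xs ! i) \<le> arr xs i"
  using assms(2)
proof (induction i)
  case 0
  with assms(1) show ?case using route_nth_0 d_self source_less by simp
next
  case (Suc i)
  then have "xs ! i < n" "xs ! Suc i < n" using assms(1) by (auto intro!: route_nth_less)
  with Suc d_triangle[of "source N" "xs ! i" "xs ! Suc i"] source_less
  show ?case by (simp add: arrival_Suc)
qed

text \<open>Such routes are the labels of the program.\<close>

definition simple_route :: "nat list \<Rightarrow> bool" where
  "simple_route zs \<longleftrightarrow> route N zs \<and> distinct zs"

lemma simple_route_length: "simple_route zs \<Longrightarrow> length zs \<le> n"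
  unfolding simple_route_def route_def verts_def
  by (metis card_lessThan card_mono distinct_card finite_lessThan)

lemma simple_route_length_pos: "simple_route zs \<Longrightarrow> 0 < length zs"
  by (simp add: simple_route_def route_def)

text \<open>A list without repetitions that has \<open>n\<close> entries among \<open>n\<close>
  vertices exhausts them, so complete labels are recognised by their length alone.\<close>

lemma feasible_route_iff: "feasible_route N zs \<longleftrightarrow> simple_route zs \<and> length zs = n"
proof
  assume "feasible_route N zs"
  then show "simple_route zs \<and> length zs = n"
    unfolding feasible_route_def simple_route_def verts_def by (metis card_lessThan distinct_card)
next
  assume *: "simple_route zs \<and> length zs = n"
  then have "set zs = verts N"
    unfolding simple_route_def route_def verts_def
    by (metis card_lessThan card_subset_eq distinct_card finite_lessThan)
  with * show "feasible_route N zs" unfolding feasible_route_def simple_route_def by simp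
qed

section \<open>Visit times and the objective function\<close>

lemma visit_time_nth:
  assumes "distinct zs" "i < length zs"
  shows "visit_time N zs (zs ! i) = arr zs i"
proof -
  have "(LEAST j. j < length zs \<and> zs ! j = zs ! i) = i"
    using assms by (intro Least_equality) (auto simp: nth_eq_iff_index_eq)
  then show ?thesis by (simp add: visit_time_def)
qed

definition cost :: "real \<Rightarrow> nat list \<Rightarrow> real" where
  "cost p zs = (\<Sum>i<length zs. \<bar>arr zs i\<bar> powr p)"

lemma cost_nonneg: "0 \<le> cost p zs"
  by (simp add: cost_def sum_nonneg)

lemma lp_objective_eq:
  assumes "feasible_route N zs"
  shows "lp_objective p N zs = cost p zs powr (1 / p)"
proof -
  have zs: "distinct zs" "set zs = verts N" using assms by (auto simp: feasible_route_def)
  have "bij_betw ((!) zs) {..<length zs} (verts N)" using zs by (intro bij_betw_nth) auto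
  then have "(\<Sum>v\<in>verts N. \<bar>visit_time N zs v\<bar> powr p) =
      (\<Sum>i<length zs. \<bar>visit_time N zs (zs ! i)\<bar> powr p)"
    by (rule sum.reindex_bij_betw[symmetric])
  also have "\<dots> = cost p zs" using zs by (simp add: cost_def visit_time_nth)
  finally show ?thesis by (simp add: lp_objective_def)
qed

lemma lp_opt_attained:
  obtains zs where "feasible_route N zs" "lp_objective p N zs = lp_opt p N"
proof -
  let ?R = "{xs. feasible_route N xs}"
  have "?R \<subseteq> {xs. set xs \<subseteq> {..<n} \<and> length xs = n}"
    by (auto simp: feasible_route_iff simple_route_def route_def verts_def)
  then have fin: "finite ?R" by (rule finite_subset) (simp add: finite_lists_length_eq)
  have "feasible_route N (source N # remove1 (source N) [0..<n])"
    using source_less by (auto simp: feasible_route_def route_def verts_def)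
  then have "?R \<noteq> {}" by blast
  with fin have "lp_opt p N \<in> lp_objective p N ` ?R"
    unfolding lp_opt_def by (intro Min_in) auto
  then show ?thesis using that by auto
qed

section \<open>Appending the new vertices of a walk to a simple route\<close>

definition finish :: "nat list \<Rightarrow> real" where
  "finish zs = arr zs (length zs - 1)"

text \<open>The guard \<open>w < n\<close> is for answers to infeasible instances, which may contain
  any numbers. The cap \<open>b\<close> stops the label at the guessed count, with which the next
  chunk has to start.\<close>

definition visit_new :: "nat \<Rightarrow> nat \<Rightarrow> nat list \<Rightarrow> nat list" where
  "visit_new b w zs = (if w < n \<and> length zs < b \<and> w \<notin> set zs then zs @ [w] else zs)"

definition extend :: "nat \<Rightarrow> nat list \<Rightarrow> nat list \<Rightarrow> nat list" where
  "extend b zs xs = fold (visit_new b) xs zs"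

lemma extend_append: "extend b zs (xs @ ys) = extend b (extend b zs xs) ys"
  by (simp add: extend_def)

lemma extend_snoc: "extend b zs (xs @ [w]) = visit_new b w (extend b zs xs)"
  by (simp add: extend_def)

lemma visit_new_simple: "simple_route zs \<Longrightarrow> simple_route (visit_new b w zs)"
  by (auto simp: visit_new_def simple_route_def route_def verts_def)

lemma extend_simple: "simple_route zs \<Longrightarrow> simple_route (extend b zs xs)"
  by (induction xs rule: rev_induct) (simp_all add: extend_snoc visit_new_simple extend_def[of _ _ "[]"])

lemma extend_prefix: "\<exists>ys. extend b zs xs = zs @ ys"
proof (induction xs rule: rev_induct)
  case (snoc w xs)
  then show ?case by (auto simp: extend_snoc visit_new_def)
qed (simp add: extend_def)

lemma length_extend_ge: "length zs \<le> length (extend b zs xs)"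
  using extend_prefix[of b zs xs] by auto

lemma length_extend_le: "length zs \<le> b \<Longrightarrow> length (extend b zs xs) \<le> b"
  by (induction xs rule: rev_induct) (auto simp: extend_snoc visit_new_def extend_def[of _ _ "[]"])

lemma arrival_extend: "i < length zs \<Longrightarrow> arr (extend b zs xs) i = arr zs i"
  using extend_prefix[of b zs xs] by (auto simp: arrival_append)

lemma finish_snoc: "zs \<noteq> [] \<Longrightarrow> finish (zs @ [w]) = finish zs + d (last zs) w"
proof (cases zs rule: rev_cases)
  case (snoc ys y)
  then have "arr (zs @ [w]) (length ys) = arr zs (length ys)" by (intro arrival_append) simp
  then show ?thesis using snoc by (simp add: finish_def arrival_Suc nth_append)
qed simp

lemma arrival_length: "zs \<noteq> [] \<Longrightarrow> arr (zs @ [w]) (length zs) = finish zs + d (last zs) w"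
  using finish_snoc[of zs w] by (simp add: finish_def)

lemma simple_route_last_less: "simple_route zs \<Longrightarrow> last zs < n"
  by (auto simp: simple_route_def route_def verts_def subset_iff)

text \<open>
  Going back to the source from the end of \<open>zs\<close> takes time at most \<open>finish zs\<close>; skipping
  vertices does not make the traveler later.
\<close>

lemma finish_extend_take:
  assumes "simple_route zs" "route N xs" "j < length xs"
  shows "finish (extend b zs (take j xs)) + d (last (extend b zs (take j xs))) (xs ! j)
    \<le> 2 * finish zs + arr xs j"
  using assms(3)
proof (induction j)
  case 0
  have "d (source N) (last zs) \<le> finish zs"
    using travel_le_arrival[of zs "length zs - 1"] assms(1)
    by (auto simp: finish_def last_conv_nth simple_route_def route_def)
  then show ?case
    using d_commute[OF source_less simple_route_last_less[OF assms(1)]] assms(2)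
    by (simp add: route_nth_0 extend_def)
next
  case (Suc j)
  define zs' where "zs' = extend b zs (take j xs)"
  have simple: "simple_route zs'" unfolding zs'_def using assms(1) by (rule extend_simple)
  have less: "xs ! j < n" "xs ! Suc j < n"
    using Suc.prems assms(2) by (auto intro!: route_nth_less)
  have IH: "finish zs' + d (last zs') (xs ! j) \<le> 2 * finish zs + arr xs j"
    using Suc unfolding zs'_def by simp
  have eq: "extend b zs (take (Suc j) xs) = visit_new b (xs ! j) zs'"
    using Suc.prems by (simp add: take_Suc_conv_app_nth extend_snoc zs'_def)
  have "zs' \<noteq> []" using simple by (auto simp: simple_route_def route_def)
  with IH d_triangle[OF simple_route_last_less[OF simple] less] show ?case
    unfolding eq by (auto simp: visit_new_def finish_snoc arrival_Suc)
qed

text \<open>Each appended vertex is an entry of the walk, so the estimate at the moment of its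
  appending applies to it; appending further vertices does not change its arrival.\<close>

lemma arrival_extend_take:
  assumes "simple_route zs" "route N xs" "j \<le> length xs"
    and "\<And>j'. j' < j \<Longrightarrow> arr xs j' \<le> \<tau>"
    and "length zs \<le> i" "i < length (extend b zs (take j xs))"
  shows "arr (extend b zs (take j xs)) i \<le> 2 * finish zs + \<tau>"
  using assms(3-)
proof (induction j)
  case 0
  then show ?case by (simp add: extend_def)
next
  case (Suc j)
  define zs' where "zs' = extend b zs (take j xs)"
  have IH: "i < length zs' \<Longrightarrow> arr zs' i \<le> 2 * finish zs + \<tau>"
    using Suc unfolding zs'_def by simp
  have eq: "extend b zs (take (Suc j) xs) = visit_new b (xs ! j) zs'"
    using Suc.prems by (simp add: take_Suc_conv_app_nth extend_snoc zs'_def)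
  have "zs' \<noteq> []"
    using extend_simple[OF assms(1)] unfolding zs'_def by (auto simp: simple_route_def route_def)
  moreover have "finish zs' + d (last zs') (xs ! j) \<le> 2 * finish zs + \<tau>"
    using finish_extend_take[OF assms(1,2), of j b] Suc.prems(1) Suc.prems(2)[of j]
    unfolding zs'_def by simp
  ultimately show ?case
    using Suc.prems(4) IH unfolding eq
    by (auto simp: visit_new_def arrival_length arrival_append less_Suc_eq split: if_splits)
qed

text \<open>A label that stays below the cap has never refused a vertex for lack of room.\<close>

lemma set_extend:
  assumes "length (extend b zs xs) < b" "set xs \<subseteq> verts N"
  shows "set xs \<subseteq> set (extend b zs xs)"
  using assms
proof (induction xs rule: rev_induct)
  case (snoc w xs)
  then show ?case
    by (auto simp: extend_snoc visit_new_def verts_def split: if_splits)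
qed simp

text \<open>Arrival times do not decrease along a route, so the positions reached by time
  \<open>\<tau>\<close> form an initial segment.\<close>

lemma visited_by_take:
  assumes "route N xs"
  obtains j where "j \<le> length xs" "\<And>j'. j' < j \<Longrightarrow> arr xs j' \<le> \<tau>"
    "visited_by N xs \<tau> = set (take j xs)"
proof -
  let ?J = "{j. j < length xs \<and> arr xs j \<le> \<tau>}"
  have down: "j' \<in> ?J" if "j \<in> ?J" "j' \<le> j" for j j'
    using that arrival_mono[OF assms, of j j'] by auto
  obtain j where J: "?J = {..<j}"
  proof (cases "?J = {}")
    case False
    have fin: "finite ?J" by simp
    have "?J = {..Max ?J}" using down[OF Max_in[OF fin False]] Max_ge[OF fin] by blast
    then have "?J = {..<Suc (Max ?J)}" unfolding lessThan_Suc_atMost .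
    then show ?thesis by (rule that)
  next
    case True
    have "?J = {..<0}" unfolding True by simp
    then show ?thesis by (rule that)
  qed
  have "{..<j} \<subseteq> {..<length xs}" unfolding J[symmetric] by auto
  then have le: "j \<le> length xs" by simp
  have "visited_by N xs \<tau> = (!) xs ` ?J" by (auto simp: visited_by_def)
  also have "\<dots> = set (take j xs)" unfolding J lessThan_atLeast0 using le by (rule nth_image)
  finally have "visited_by N xs \<tau> = set (take j xs)" .
  moreover have "arr xs j' \<le> \<tau>" if "j' < j" for j'
  proof -
    have "j' \<in> ?J" unfolding J using that by simp
    then show ?thesis by simp
  qed
  ultimately show ?thesis using that[OF le] by blast
qed

text \<open>It is irrelevant which vertices are new. Unless the cap stops it, the label contains
  everything that the walk sees by \<open>\<tau>\<close>, which is more than \<open>i\<close>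
  vertices.\<close>

lemma extend_visits:
  assumes "simple_route zs" "route N xs"
    and "length zs \<le> i" "i < b" "i < card (visited_by N xs \<tau>)"
  shows "i < length (extend b zs xs)" "arr (extend b zs xs) i \<le> 2 * finish zs + \<tau>"
proof -
  obtain j where j: "j \<le> length xs" "\<And>j'. j' < j \<Longrightarrow> arr xs j' \<le> \<tau>"
    "visited_by N xs \<tau> = set (take j xs)" using visited_by_take[OF assms(2)] by metis
  let ?zs = "extend b zs (take j xs)"
  have len: "i < length ?zs"
  proof (cases "length ?zs < b")
    case True
    then have "set (take j xs) \<subseteq> set ?zs"
      using assms(2) by (intro set_extend) (auto simp: route_def dest: in_set_takeD)
    then have "card (set (take j xs)) \<le> length ?zs"
      by (meson List.finite_set card_length card_mono le_trans)
    then show ?thesis using assms(5) j(3) by simp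
  qed (use assms(4) in simp)
  have eq: "extend b zs xs = extend b ?zs (drop j xs)"
    by (metis append_take_drop_id extend_append)
  show "i < length (extend b zs xs)"
    using len length_extend_ge[of ?zs b "drop j xs"] unfolding eq by simp
  show "arr (extend b zs xs) i \<le> 2 * finish zs + \<tau>"
    using arrival_extend_take[OF assms(1,2) j(1,2) assms(3) len] arrival_extend[OF len]
    unfolding eq by simp
qed

end

section \<open>The program\<close>

abbreviation NEq :: "nexp \<Rightarrow> nexp \<Rightarrow> bexp" where
  "NEq e f \<equiv> Conj (Neg (NLess e f)) (Neg (NLess f e))"

fun conjs :: "bexp list \<Rightarrow> bexp" where
  "conjs [] = Neg (NLess (Num 0) (Num 0))"
| "conjs (b # bs) = Conj b (conjs bs)"

lemma bval_conjs [simp]: "bval p N (conjs bs) s \<longleftrightarrow> (\<forall>b\<in>set bs. bval p N b s)"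
  by (induction bs) auto

text \<open>A product with a constant, unfolded into additions because \<open>nexp\<close> has no
  multiplication.\<close>

primrec multiple :: "nat \<Rightarrow> nexp \<Rightarrow> nexp" where
  "multiple 0 e = Num 0"
| "multiple (Suc c) e = NPlus e (multiple c e)"

lemma nval_multiple [simp]: "nval (multiple c e) s = c * nval e s"
  by (induction c) auto

text \<open>
  Label \<open>i\<close> is the list of the \<open>len\<close>[\<open>i\<close>] entries of the array \<open>heap\<close> from \<open>off\<close>[\<open>i\<close>] on; the sum
  of the \<open>p\<close>-th powers of its visit times is \<open>costs\<close>[\<open>i\<close>], and the last visit time is \<open>ends\<close>[\<open>i\<close>].
  The label under construction occupies the \<open>m\<close> entries of \<open>heap\<close> from \<open>top\<close> on.

  The array \<open>g\<close> holds the current guess: the \<open>K\<close> vertex counts, the vertices \<open>x\<close> and \<open>y\<close> and the factor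
  \<open>i\<close> of the scale \<open>T\<close>, and the length of the label to be extended. It is enumerated by a counter: the
  first \<open>r\<close> entries of the array \<open>g\<close> from \<open>j\<close> on are digits in base \<open>M * (n + 1)\<close>, least
  significant digit first, and the entry after them counts the overflows.
\<close>

primrec increment :: "nat \<Rightarrow> nat \<Rightarrow> nat \<Rightarrow> com" where
  "increment M 0 j = NUpdate ''g'' (Num j) (NPlus (NArr ''g'' (Num j)) (Num 1))"
| "increment M (Suc r) j = Seq (NUpdate ''g'' (Num j) (NPlus (NArr ''g'' (Num j)) (Num 1)))
     (If (NLess (NArr ''g'' (Num j)) (multiple M (NPlus (NVar ''n'') (Num 1)))) Skip
       (Seq (NUpdate ''g'' (Num j) (Num 0)) (increment M r (Suc j))))"

text \<open>A call is stuck unless its arguments form an instance, so this has to be tested first.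
  The last two tests keep \<open>Dist\<close> inside the network, which makes the scale
  nonnegative.\<close>

definition valid_guess :: "nat \<Rightarrow> bexp" where
  "valid_guess K = conjs (
     map (\<lambda>j. Neg (NLess (NVar ''n'') (NArr ''g'' (Num j)))) [0..<K] @
     map (\<lambda>j. Neg (NLess (NArr ''g'' (Num (Suc j))) (NArr ''g'' (Num j)))) [0..<K - 1] @
     [NLess (NArr ''g'' (Num K)) (NVar ''n''), NLess (NArr ''g'' (Num (K + 1))) (NVar ''n'')])"

text \<open>Powers of \<open>q = (h + 1) / h\<close> are written as quotients of natural literals.
  The loop over the deadlines is unrolled, since their number is part of the program.\<close>

primrec set_deadlines :: "nat \<Rightarrow> nat \<Rightarrow> com" where
  "set_deadlines h 0 = Skip"
| "set_deadlines h (Suc j) = Seq (set_deadlines h j)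
     (RUpdate ''t'' (Num j) (RTimes (RVar ''T'')
       (RDivide (OfNat (Num ((h + 1) ^ j))) (OfNat (Num (h ^ j))))))"

text \<open>Label 0 is the default if none satisfies \<open>P\<close>. A label derived from it is
  still a simple route with its true cost.\<close>

definition choose_label :: "(nexp \<Rightarrow> bexp) \<Rightarrow> com" where
  "choose_label P = Seq (NAssign ''best'' (Num 0)) (Seq (NAssign ''i'' (Num 0))
     (While (NLess (NVar ''i'') (NVar ''labels'')) (Seq
       (If (Conj (P (NVar ''i'')) (Neg (Conj (P (NVar ''best''))
             (Neg (RLess (RArr ''costs'' (NVar ''i'')) (RArr ''costs'' (NVar ''best'')))))))
         (NAssign ''best'' (NVar ''i'')) Skip)
       (NAssign ''i'' (NPlus (NVar ''i'') (Num 1))))))"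

definition copy_label :: "vname \<Rightarrow> nexp \<Rightarrow> nexp \<Rightarrow> com" where
  "copy_label a e l = Seq (NAssign ''i'' (Num 0)) (While (NLess (NVar ''i'') l) (Seq
     (NUpdate a (NPlus e (NVar ''i''))
       (NArr ''heap'' (NPlus (NArr ''off'' (NVar ''best'')) (NVar ''i''))))
     (NAssign ''i'' (NPlus (NVar ''i'') (Num 1)))))"

definition search :: com where
  "search = Seq (NAssign ''found'' (Num 0)) (Seq (NAssign ''i'' (Num 0))
     (While (NLess (NVar ''i'') (NVar ''m'')) (Seq
       (If (NEq (NArr ''heap'' (NPlus (NVar ''top'') (NVar ''i''))) (NArr ''ans'' (NVar ''j'')))
         (NAssign ''found'' (Num 1)) Skip)
       (NAssign ''i'' (NPlus (NVar ''i'') (Num 1))))))"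

definition visit_next :: com where
  "visit_next = Seq (RAssign ''now'' (RPlus (RVar ''now'')
       (Dist (NArr ''heap'' (NPlus (NVar ''top'') (NMinus (NVar ''m'') (Num 1))))
         (NArr ''ans'' (NVar ''j'')))))
     (Seq (RAssign ''cost'' (RPlus (RVar ''cost'') (PowP (RVar ''now''))))
     (Seq (NUpdate ''heap'' (NPlus (NVar ''top'') (NVar ''m'')) (NArr ''ans'' (NVar ''j'')))
       (NAssign ''m'' (NPlus (NVar ''m'') (Num 1)))))"

definition extend_label :: "nat \<Rightarrow> com" where
  "extend_label K = Seq (NAssign ''j'' (Num 0)) (While (NLess (NVar ''j'') (NVar ''l'')) (Seq
     (If (Conj (NLess (NArr ''ans'' (NVar ''j'')) (NVar ''n''))
            (NLess (NVar ''m'') (NArr ''g'' (Num (K - 1)))))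
       (Seq search (If (NLess (NVar ''found'') (Num 1)) visit_next Skip)) Skip)
     (NAssign ''j'' (NPlus (NVar ''j'') (Num 1)))))"

definition add_label :: com where
  "add_label = Seq (NUpdate ''off'' (NVar ''labels'') (NVar ''top''))
     (Seq (NUpdate ''len'' (NVar ''labels'') (NVar ''m''))
     (Seq (RUpdate ''costs'' (NVar ''labels'') (RVar ''cost''))
     (Seq (RUpdate ''ends'' (NVar ''labels'') (RVar ''now''))
     (Seq (NAssign ''top'' (NPlus (NVar ''top'') (NVar ''m'')))
       (NAssign ''labels'' (NPlus (NVar ''labels'') (Num 1)))))))"

definition try_guess :: "nat \<Rightarrow> nat \<Rightarrow> nat \<Rightarrow> nat \<Rightarrow> com" where
  "try_guess K h M \<beta> =
     Seq (RAssign ''T'' (RDivide (RTimes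
       (Dist (NArr ''g'' (Num K)) (NArr ''g'' (Num (K + 1)))) (OfNat (NArr ''g'' (Num (K + 2)))))
       (OfNat (Num M))))
     (Seq (set_deadlines h K)
     (Seq (choose_label (\<lambda>e. Conj (NEq (NArr ''len'' e) (NArr ''g'' (Num (K + 3))))
       (Neg (RLess (RTimes (OfNat (Num \<beta>)) (RVar ''T'')) (RArr ''ends'' e)))))
     (Seq (Call ''g'' ''t'' ''ans'' ''l'')
     (Seq (NAssign ''m'' (NArr ''len'' (NVar ''best'')))
     (Seq (RAssign ''cost'' (RArr ''costs'' (NVar ''best'')))
     (Seq (RAssign ''now'' (RArr ''ends'' (NVar ''best'')))
     (Seq (copy_label ''heap'' (NVar ''top'') (NVar ''m''))
     (Seq (extend_label K) add_label))))))))"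

definition iteration :: "nat \<Rightarrow> nat \<Rightarrow> nat \<Rightarrow> nat \<Rightarrow> com" where
  "iteration K h M \<beta> =
     Seq (If (valid_guess K) (try_guess K h M \<beta>) Skip) (increment M (K + 4) 0)"

definition initialise :: com where
  "initialise = Seq (NAssign ''labels'' (Num 1)) (Seq (NAssign ''top'' (Num 1))
     (Seq (NUpdate ''heap'' (Num 0) (NVar ''s'')) (NUpdate ''len'' (Num 0) (Num 1))))"

definition lp_program :: "nat \<Rightarrow> nat \<Rightarrow> nat \<Rightarrow> nat \<Rightarrow> com" where
  "lp_program K h M \<beta> = Seq initialise
     (Seq (While (NLess (NArr ''g'' (Num (K + 4))) (NVar ''n'')) (iteration K h M \<beta>))
     (Seq (choose_label (\<lambda>e. NEq (NArr ''len'' e) (NVar ''n'')))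
       (copy_label ''out'' (Num 0) (NVar ''n''))))"

section \<open>Frame conditions and the selection of a label\<close>

definition keeps :: "vname set \<Rightarrow> state \<Rightarrow> state \<Rightarrow> bool" where
  "keeps X s t \<longleftrightarrow> (\<forall>x. x \<notin> X \<longrightarrow>
     nvar t x = nvar s x \<and> rvar t x = rvar s x \<and> narr t x = narr s x \<and> rarr t x = rarr s x)"

lemma keeps_refl: "keeps X s s"
  by (simp add: keeps_def)

lemma keeps_trans: "keeps X s t \<Longrightarrow> keeps Y t u \<Longrightarrow> X \<subseteq> Z \<Longrightarrow> Y \<subseteq> Z \<Longrightarrow> keeps Z s u"
  unfolding keeps_def by (metis subsetD)

lemma keepsD:
  assumes "keeps X s t" "x \<notin> X"
  shows "nvar t x = nvar s x" "rvar t x = rvar s x" "narr t x = narr s x" "rarr t x = rarr s x"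
  using assms by (simp_all add: keeps_def)

text \<open>The functional counterpart of the loop in \<open>choose_label\<close>, including the
  default 0; it makes the loop invariant an equation.\<close>

primrec cheapest :: "(nat \<Rightarrow> bool) \<Rightarrow> (nat \<Rightarrow> real) \<Rightarrow> nat \<Rightarrow> nat" where
  "cheapest P f 0 = 0"
| "cheapest P f (Suc i) = (let b = cheapest P f i in
     if P i \<and> \<not> (P b \<and> \<not> f i < f b) then i else b)"

lemma cheapest_less: "0 < m \<Longrightarrow> cheapest P f m < m"
proof (induction m)
  case (Suc m)
  then show ?case by (cases "m = 0") (auto simp: Let_def)
qed simp

lemma cheapest_min:
  assumes "i < m" "P i"
  shows "P (cheapest P f m) \<and> f (cheapest P f m) \<le> f i"
  using assms(1)
proof (induction m)
  case (Suc m)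
  show ?case
  proof (cases "i = m")
    case False
    with Suc have "P (cheapest P f m) \<and> f (cheapest P f m) \<le> f i" by simp
    then show ?thesis by (auto simp: Let_def)
  qed (use assms(2) in \<open>auto simp: Let_def\<close>)
qed simp

lemma cheapest_cong:
  "(\<And>i. i < m \<Longrightarrow> P i = P' i) \<Longrightarrow> (\<And>i. i < m \<Longrightarrow> f i = f' i) \<Longrightarrow> cheapest P f m = cheapest P' f' m"
proof (induction m)
  case (Suc m)
  then have IH: "cheapest P f m = cheapest P' f' m" by simp
  show ?case
  proof (cases "m = 0")
    case True
    then show ?thesis by simp
  next
    case False
    then have "cheapest P' f' m < Suc m" using cheapest_less[of m P' f'] by simp
    then show ?thesis using Suc.prems by (simp add: IH)
  qed
qed simp

section \<open>Correctness of the counter, of the selection and of copying\<close>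

context machine
begin

text \<open>Here \<open>v\<close> is the number whose digits start at entry \<open>j\<close>; a
  carry leaves \<open>v div B\<close> to the entries behind it.\<close>

lemma wp_increment:
  assumes "nvar s ''n'' = n" "B = M * (n + 1)" "0 < B"
    and "\<And>i. i < r \<Longrightarrow> narr s ''g'' (j + i) = v div B ^ i mod B" "narr s ''g'' (j + r) = v div B ^ r"
  shows "wp (increment M r j) (\<lambda>t m rs. rs = [] \<and> m \<le> 4 * r + 1 \<and> keeps {''g''} s t \<and>
    (\<forall>i<j. narr t ''g'' i = narr s ''g'' i) \<and>
    (\<forall>i<r. narr t ''g'' (j + i) = Suc v div B ^ i mod B) \<and>
    narr t ''g'' (j + r) = Suc v div B ^ r) s"
  using assms(1,4,5)
proof (induction r arbitrary: j v s)
  case 0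
  then show ?case by (simp add: keeps_def)
next
  case (Suc r)
  have g0: "narr s ''g'' j = v mod B" using Suc.prems(2)[of 0] by simp
  have g: "narr s ''g'' (Suc j + i) = v div B div B ^ i mod B" if "i < r" for i
    using Suc.prems(2)[of "Suc i"] that by (simp add: div_mult2_eq)
  have gr: "narr s ''g'' (Suc j + r) = v div B div B ^ r"
    using Suc.prems(3) by (simp add: div_mult2_eq)
  show ?case
  proof (cases "Suc (v mod B) < B")
    case True
    then have v: "Suc v mod B = Suc (v mod B)" "Suc v div B = v div B"
      by (simp_all add: mod_Suc div_Suc)
    have "narr s ''g'' (j + i) = Suc v div B ^ i mod B" if "0 < i" "i \<le> r" for i
      using that g[of "i - 1"] v by (cases i) (auto simp: div_mult2_eq)
    moreover have "narr s ''g'' (Suc (j + r)) = Suc v div B ^ Suc r"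
      using gr v by (simp add: div_mult2_eq)
    ultimately show ?thesis
      using True g0 v Suc.prems(1) assms(2)
      by (auto simp: keeps_def less_Suc_eq_le)
  next
    case False
    moreover have "v mod B < B" using assms(3) by simp
    ultimately have "Suc (v mod B) = B" by simp
    then have v: "Suc v mod B = 0" "Suc v div B = Suc (v div B)"
      by (simp_all add: mod_Suc div_Suc)
    let ?s = "s\<lparr>narr := (narr s)(''g'' := (narr s ''g'')(j := 0))\<rparr>"
    have IH: "wp (increment M r (Suc j)) (\<lambda>t m rs. rs = [] \<and> m \<le> 4 * r + 1 \<and> keeps {''g''} ?s t \<and>
      (\<forall>i<Suc j. narr t ''g'' i = narr ?s ''g'' i) \<and>
      (\<forall>i<r. narr t ''g'' (Suc j + i) = Suc (v div B) div B ^ i mod B) \<and>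
      narr t ''g'' (Suc j + r) = Suc (v div B) div B ^ r) ?s"
      by (rule Suc.IH) (use Suc.prems(1) g gr in auto)
    have split: "(\<forall>i<Suc r. P i) \<longleftrightarrow> P 0 \<and> (\<forall>i<r. P (Suc i))" for P
      by (auto simp: less_Suc_eq_0_disj)
    have "\<not> Suc (v mod B) < M * Suc n" using False assms(2) by simp
    then show ?thesis
      using g0 Suc.prems(1)
      apply simp
      apply (rule wp_mono[OF IH])
      apply (auto simp: keeps_def split v div_mult2_eq)
      done
  qed
qed

lemma wp_set_deadlines:
  "wp (set_deadlines h r) (\<lambda>t m rs. rs = [] \<and> m \<le> r + 1 \<and> keeps {''t''} s t \<and>
    (\<forall>j<r. rarr t ''t'' j = rvar s ''T'' * (real ((h + 1) ^ j) / real (h ^ j)))) s"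
proof (induction r)
  case (Suc r)
  show ?case
    apply simp
    apply (rule wp_mono[OF Suc])
    apply (auto simp: keeps_def less_Suc_eq)
    done
qed (simp add: keeps_refl)

lemma wp_choose_label:
  assumes P: "\<And>t x. keeps {''best'', ''i''} s t \<Longrightarrow> bval p N (P (NVar x)) t \<longleftrightarrow> P' (nvar t x)"
    and l: "nvar s ''labels'' = l"
  shows "wp (choose_label P) (\<lambda>t m rs. rs = [] \<and> m \<le> 4 * l + 3 \<and> keeps {''best'', ''i''} s t \<and>
    nvar t ''best'' = cheapest P' (rarr s ''costs'') l) s"
  unfolding choose_label_def
  apply simp
  apply (rule wp_While_callfree[where n = l and \<tau> = 3 and I = "\<lambda>i t. keeps {''best'', ''i''} s t \<and>
    nvar t ''i'' = i \<and> nvar t ''best'' = cheapest P' (rarr s ''costs'') i"])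
     apply (simp add: keeps_def)
  subgoal for i t
    using P[of t "''i''"] P[of t "''best''"] keepsD[of "{''best'', ''i''}" s t "''costs''"]
      keepsD[of "{''best'', ''i''}" s t "''labels''"] l
    by (auto simp: keeps_def Let_def)
  using l by (auto simp: keeps_def)

text \<open>If source and target share the array \<open>''heap''\<close>, the label has to end
  before the target starts; then no entry is overwritten before it is read.\<close>

lemma wp_copy_label:
  assumes e: "\<And>t. keeps {''i'', a} s t \<Longrightarrow> nval e t = e'" and l: "\<And>t. keeps {''i'', a} s t \<Longrightarrow> nval l t = l'"
    and o': "narr s ''off'' (nvar s ''best'') = o'"
    and a: "a = ''heap'' \<and> o' + l' \<le> e' \<or> a = ''out''"
  shows "wp (copy_label a e l) (\<lambda>t m rs. rs = [] \<and> m \<le> 3 * l' + 2 \<and> keeps {''i'', a} s t \<and>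
    (\<forall>i<l'. narr t a (e' + i) = narr s ''heap'' (o' + i)) \<and>
    (\<forall>x<e'. narr t a x = narr s a x)) s"
proof -
  let ?I = "\<lambda>i t. keeps {''i'', a} s t \<and> nvar t ''i'' = i \<and>
    (\<forall>i'<i. narr t a (e' + i') = narr s ''heap'' (o' + i')) \<and> (\<forall>x<e'. narr t a x = narr s a x)"
  have step: "?I (Suc i) (t\<lparr>narr := (narr t)(a := (narr t a)(nval e t + nvar t ''i'' :=
      narr t ''heap'' (narr t ''off'' (nvar t ''best'') + nvar t ''i''))),
      nvar := (nvar t)(''i'' := Suc (nvar t ''i''))\<rparr>)" if "i < l'" "?I i t" for i t
  proof -
    have "''off'' \<notin> {''i'', a}" "''best'' \<notin> {''i'', a}" using a by auto
    then have "narr t ''off'' (nvar t ''best'') = o'"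
      using o' keepsD(1,3)[OF conjunct1[OF that(2)]] by metis
    moreover have "nval e t = e'" using e that(2) by blast
    ultimately have eqs: "narr t ''off'' (nvar t ''best'') = o'" "nval e t = e'" .
    have "narr t ''heap'' (o' + i) = narr s ''heap'' (o' + i)"
      using a
    proof
      assume "a = ''heap'' \<and> o' + l' \<le> e'"
      then have "o' + i < e'" "a = ''heap''" using that(1) by simp_all
      with that(2) show ?thesis by simp
    next
      assume "a = ''out''"
      then have "''heap'' \<notin> {''i'', a}" by simp
      then show ?thesis using keepsD(3)[OF conjunct1[OF that(2)]] by metis
    qed
    with that show ?thesis unfolding eqs by (simp add: keeps_def less_Suc_eq del: fun_upd_apply) (auto simp: fun_upd_apply)
  qed
  show ?thesis
    unfolding copy_label_def
    apply simp
    apply (rule wp_While_callfree[where n = l' and \<tau> = 2 and I = ?I])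
    subgoal by (simp add: keeps_def)
    subgoal for i t using step[of i t] l[of t] by simp
    subgoal for t using l[of t] by simp
    subgoal by simp
    done
qed

end

text \<open>One component of \<open>keeps\<close>, stated for a single function so that it
  simplifies through the updates of straight-line code.\<close>

definition agree :: "vname set \<Rightarrow> (vname \<Rightarrow> 'a) \<Rightarrow> (vname \<Rightarrow> 'a) \<Rightarrow> bool" where
  "agree X f g \<longleftrightarrow> (\<forall>x. x \<notin> X \<longrightarrow> g x = f x)"

lemma agree_simps [simp]: "agree X f f" "x \<in> X \<Longrightarrow> agree X f (g(x := v)) \<longleftrightarrow> agree X f g"
  by (auto simp: agree_def)

lemma keeps_agree: "keeps X s t \<longleftrightarrow> agree X (nvar s) (nvar t) \<and> agree X (rvar s) (rvar t) \<and>
    agree X (narr s) (narr t) \<and> agree X (rarr s) (rarr t)"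
  by (auto simp: keeps_def agree_def)

section \<open>Construction of a label from one answer\<close>

locale program = machine p K A N + metric N for p :: real and K A N +
  fixes h M \<beta> :: nat
  assumes K_pos: "0 < K" and h_pos: "0 < h" and M_pos: "0 < M"
begin

definition current :: "nat list \<Rightarrow> state \<Rightarrow> bool" where
  "current zs t \<longleftrightarrow> nvar t ''m'' = length zs \<and>
     (\<forall>i<length zs. narr t ''heap'' (nvar t ''top'' + i) = zs ! i) \<and>
     rvar t ''cost'' = cost p zs \<and> rvar t ''now'' = finish zs"

lemma wp_search:
  assumes "current zs s"
  shows "wp search (\<lambda>t m rs. rs = [] \<and> m \<le> 4 * length zs + 3 \<and> keeps {''found'', ''i''} s t \<and>
    (nvar t ''found'' < 1 \<longleftrightarrow> narr s ''ans'' (nvar s ''j'') \<notin> set zs)) s"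
proof -
  let ?w = "narr s ''ans'' (nvar s ''j'')"
  let ?I = "\<lambda>i t. keeps {''found'', ''i''} s t \<and> nvar t ''i'' = i \<and>
      (nvar t ''found'' = 0 \<longleftrightarrow> ?w \<notin> set (take i zs))"
  let ?step = "Seq (If (NEq (NArr ''heap'' (NPlus (NVar ''top'') (NVar ''i''))) (NArr ''ans'' (NVar ''j'')))
         (NAssign ''found'' (Num 1)) Skip)
       (NAssign ''i'' (NPlus (NVar ''i'') (Num 1)))"
  have step: "wp ?step (\<lambda>t' m rs. ?I (Suc i) t' \<and> rs = [] \<and> m \<le> 3) t" if i: "i < length zs" and I: "?I i t" for i t
  proof -
    have eqs: "nvar t ''top'' = nvar s ''top''" "nvar t ''i'' = i"
      "nvar t ''j'' = nvar s ''j''" "narr t ''ans'' = narr s ''ans''"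
      "narr t ''heap'' (nvar s ''top'' + i) = zs ! i"
      using I i assms by (simp_all add: keeps_def current_def)
    have set: "set (take (Suc i) zs) = insert (zs ! i) (set (take i zs))"
      using i by (simp add: take_Suc_conv_app_nth)
    have keeps: "keeps {''found'', ''i''} s t" using I by simp
    show ?thesis
    proof (cases "zs ! i = ?w")
      case True
      with keeps show ?thesis by (simp add: eqs set keeps_agree)
    next
      case False
      with keeps I show ?thesis by (auto simp: eqs set keeps_agree)
    qed
  qed
  show ?thesis
    unfolding search_def
    apply (simp del: wp_If)
    apply (rule wp_While_callfree[where n = "length zs" and \<tau> = 3 and I = ?I])
    subgoal by (simp add: keeps_agree)
    subgoal for i t
    proof -
      assume i: "i < length zs" and I: "?I i t"
      then have "nvar t ''m'' = length zs" "nvar t ''i'' = i"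
        using assms by (simp_all add: keeps_def current_def)
      with step[OF i I] i show ?thesis by simp
    qed
    subgoal for t
    proof -
      assume I: "?I (length zs) t"
      then have "nvar t ''m'' = length zs" "nvar t ''i'' = length zs"
        using assms by (simp_all add: keeps_def current_def)
      then show ?thesis by simp
    qed
    subgoal by simp
    done
qed

lemma cost_snoc:
  assumes "zs \<noteq> []"
  shows "cost p (zs @ [w]) = cost p zs + \<bar>finish (zs @ [w])\<bar> powr p"
  by (simp add: cost_def finish_def arrival_append)

lemma wp_visit_next:
  assumes "current zs s" "zs \<noteq> []"
  shows "wp visit_next (\<lambda>t m rs. rs = [] \<and> m = 4 \<and> keeps {''now'', ''cost'', ''heap'', ''m''} s t \<and>
    current (zs @ [narr s ''ans'' (nvar s ''j'')]) t \<and>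
    (\<forall>x<nvar s ''top''. narr t ''heap'' x = narr s ''heap'' x)) s"
proof -
  \<comment> \<open>The position \<open>m - 1\<close> uses truncated subtraction and is the last
    entry only because \<open>zs\<close> is not empty.\<close>
  have "narr s ''heap'' (nvar s ''top'' + (length zs - 1)) = last zs"
    using assms by (simp add: current_def last_conv_nth)
  then show ?thesis
    using assms unfolding visit_next_def
    by (auto simp: keeps_agree current_def cost_snoc finish_snoc nth_append less_Suc_eq)
qed

text \<open>Every entry of the answer may cause a search through a label of up to \<open>n\<close>
  vertices, whence \<open>4 * n + 12\<close> steps per entry. Cells below \<open>''top''\<close> are
  preserved, as they hold the earlier labels.\<close>

lemma wp_extend_label:
  assumes cur: "current zs s" and zs: "simple_route zs" and n: "nvar s ''n'' = n"
    and l: "nvar s ''l'' = length xs" and xs: "\<And>j. j < length xs \<Longrightarrow> narr s ''ans'' j = xs ! j"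
  defines "X \<equiv> {''i'', ''j'', ''found'', ''now'', ''cost'', ''heap'', ''m''}"
  shows "wp (extend_label K) (\<lambda>t m rs. rs = [] \<and> m \<le> length xs * (4 * n + 12) + 2 \<and> keeps X s t \<and>
    current (extend (narr s ''g'' (K - 1)) zs xs) t \<and>
    (\<forall>x<nvar s ''top''. narr t ''heap'' x = narr s ''heap'' x)) s"
proof -
  let ?b = "narr s ''g'' (K - 1)"
  let ?I = "\<lambda>j t. keeps X s t \<and> nvar t ''j'' = j \<and> current (extend ?b zs (take j xs)) t \<and>
    (\<forall>x<nvar s ''top''. narr t ''heap'' x = narr s ''heap'' x)"
  let ?visit = "If (Conj (NLess (NArr ''ans'' (NVar ''j'')) (NVar ''n''))
            (NLess (NVar ''m'') (NArr ''g'' (Num (K - 1)))))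
       (Seq search (If (NLess (NVar ''found'') (Num 1)) visit_next Skip)) Skip"
  have step: "wp ?visit
     (\<lambda>t' m rs. rs = [] \<and> m \<le> 4 * n + 9 \<and> keeps X s t' \<and> nvar t' ''j'' = j \<and>
       current (extend ?b zs (take (Suc j) xs)) t' \<and>
       (\<forall>x<nvar s ''top''. narr t' ''heap'' x = narr s ''heap'' x)) t"
    if j: "j < length xs" and I: "?I j t" for j t
  proof -
    define zs' where "zs' = extend ?b zs (take j xs)"
    define w where "w = xs ! j"
    have I': "keeps X s t" "nvar t ''j'' = j" "current zs' t"
      "\<And>x. x < nvar s ''top'' \<Longrightarrow> narr t ''heap'' x = narr s ''heap'' x"
      using I by (simp_all add: zs'_def)
    have eq: "extend ?b zs (take (Suc j) xs) = visit_new ?b w zs'"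
      using j by (simp add: take_Suc_conv_app_nth extend_snoc zs'_def w_def)
    have eqs: "narr t ''ans'' j = w" "nvar t ''n'' = n" "narr t ''g'' = narr s ''g''"
      "nvar t ''top'' = nvar s ''top''" "nvar t ''m'' = length zs'"
      using I' xs[OF j] n by (simp_all add: keeps_def X_def w_def current_def)
    have simple: "simple_route zs'" unfolding zs'_def using zs by (rule extend_simple)
    then have len: "length zs' \<le> n" "zs' \<noteq> []"
      using simple_route_length simple_route_length_pos[of zs'] by auto
    show ?thesis
    proof (cases "w < n \<and> length zs' < ?b")
      case False
      then show ?thesis using I' unfolding eq by (auto simp: eqs visit_new_def)
    next
      case True
      have "wp search (\<lambda>u m rs. wp (If (NLess (NVar ''found'') (Num 1)) visit_next Skip)
        (\<lambda>t' m' rs'. rs @ rs' = [] \<and> Suc (m + m') \<le> 4 * n + 9 \<and> keeps X s t' \<and> nvar t' ''j'' = j \<and>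
          current (visit_new ?b w zs') t' \<and>
          (\<forall>x<nvar s ''top''. narr t' ''heap'' x = narr s ''heap'' x)) u) t"
      proof (rule wp_mono[OF wp_search[OF I'(3)]], elim conjE)
        fix u and m :: nat and rs :: "nat list list"
        assume u: "rs = []" "m \<le> 4 * length zs' + 3" "keeps {''found'', ''i''} t u"
          "(nvar u ''found'' < 1) = (narr t ''ans'' (nvar t ''j'') \<notin> set zs')"
        have cur: "current zs' u" using I'(3) u(3) by (simp add: current_def keeps_def)
        have eqs': "narr u ''ans'' (nvar u ''j'') = w" "nvar u ''top'' = nvar s ''top''"
          "narr u ''heap'' = narr t ''heap''" "nvar u ''j'' = j"
          using u(3) I'(2) eqs by (simp_all add: keeps_def)
        have keeps: "keeps X s u" by (rule keeps_trans[OF I'(1) u(3)]) (simp_all add: X_def)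
        have found: "nvar u ''found'' < 1 \<longleftrightarrow> w \<notin> set zs'" using u(4) I'(2) eqs(1) by simp
        show "wp (If (NLess (NVar ''found'') (Num 1)) visit_next Skip)
          (\<lambda>t' m' rs'. rs @ rs' = [] \<and> Suc (m + m') \<le> 4 * n + 9 \<and> keeps X s t' \<and> nvar t' ''j'' = j \<and>
          current (visit_new ?b w zs') t' \<and>
          (\<forall>x<nvar s ''top''. narr t' ''heap'' x = narr s ''heap'' x)) u"
        proof (cases "w \<in> set zs'")
          case True
          then have "\<not> nvar u ''found'' < 1" using found by simp
          then show ?thesis
            using True u(1,2) len(1) cur keeps I'(4) by (simp add: visit_new_def eqs')
        next
          case False
          then have "nvar u ''found'' < 1" using found by simp
          moreover have "wp visit_next (\<lambda>t' m' rs'. rs @ rs' = [] \<and> Suc (m + Suc m') \<le> 4 * n + 9 \<and>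
            keeps X s t' \<and> nvar t' ''j'' = j \<and> current (visit_new ?b w zs') t' \<and>
            (\<forall>x<nvar s ''top''. narr t' ''heap'' x = narr s ''heap'' x)) u"
          proof (rule wp_mono[OF wp_visit_next[OF cur len(2)]], elim conjE)
            fix t' and m' :: nat and rs' :: "nat list list"
            assume t': "rs' = []" "m' = 4" "keeps {''now'', ''cost'', ''heap'', ''m''} u t'"
              "current (zs' @ [narr u ''ans'' (nvar u ''j'')]) t'"
              "\<forall>x<nvar u ''top''. narr t' ''heap'' x = narr u ''heap'' x"
            have "keeps X s t'" by (rule keeps_trans[OF keeps t'(3)]) (simp_all add: X_def)
            moreover have "nvar t' ''j'' = j" using t'(3) eqs'(4) by (simp add: keeps_def)
            ultimately show "rs @ rs' = [] \<and> Suc (m + Suc m') \<le> 4 * n + 9 \<and>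
              keeps X s t' \<and> nvar t' ''j'' = j \<and> current (visit_new ?b w zs') t' \<and>
              (\<forall>x<nvar s ''top''. narr t' ''heap'' x = narr s ''heap'' x)"
              using t' t'(4)[unfolded eqs'(1)] u(1,2) len(1) False True I'(4) by (simp add: visit_new_def eqs')
          qed
          ultimately show ?thesis by simp
        qed
      qed
      then show ?thesis using True unfolding eq by (simp add: eqs I'(2) conj_assoc)
    qed
  qed
  show ?thesis
    unfolding extend_label_def
    apply (simp del: wp_If)
    apply (rule wp_While_callfree[where n = "length xs" and \<tau> = "4 * n + 11" and I = ?I])
    subgoal using cur by (simp add: keeps_agree X_def current_def extend_def)
    subgoal for j t
    proof -
      assume j: "j < length xs" and I: "?I j t"
      then have "nvar t ''l'' = length xs" using l by (simp add: keeps_def X_def)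
      moreover have "wp ?visit (\<lambda>u m rs. wp (NAssign ''j'' (NPlus (NVar ''j'') (Num 1)))
        (\<lambda>t' m' rs'. ?I (Suc j) t' \<and> rs @ rs' = [] \<and> m + m' \<le> 4 * n + 11) u) t"
        by (rule wp_mono[OF step[OF j I]]) (auto simp: keeps_agree X_def current_def)
      ultimately show ?thesis using I j by (simp del: wp_If)
    qed
    subgoal for t
    proof -
      assume I: "?I (length xs) t"
      then have "nvar t ''l'' = length xs" using l by (simp add: keeps_def X_def)
      with I show ?thesis by simp
    qed
    subgoal by (auto simp: algebra_simps)
    done
qed

lemma wp_add_label:
  "wp add_label (\<lambda>t m rs. rs = [] \<and> m = 6 \<and>
    keeps {''off'', ''len'', ''costs'', ''ends'', ''top'', ''labels''} s t \<and>
    narr t ''off'' = (narr s ''off'')(nvar s ''labels'' := nvar s ''top'') \<and>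
    narr t ''len'' = (narr s ''len'')(nvar s ''labels'' := nvar s ''m'') \<and>
    rarr t ''costs'' = (rarr s ''costs'')(nvar s ''labels'' := rvar s ''cost'') \<and>
    rarr t ''ends'' = (rarr s ''ends'')(nvar s ''labels'' := rvar s ''now'') \<and>
    nvar t ''top'' = nvar s ''top'' + nvar s ''m'' \<and> nvar t ''labels'' = Suc (nvar s ''labels'')) s"
  unfolding add_label_def by (simp add: keeps_agree)


definition valid :: "(nat \<Rightarrow> nat) \<Rightarrow> bool" where
  "valid g \<longleftrightarrow> (\<forall>j<K. g j \<le> n) \<and> (\<forall>j. Suc j < K \<longrightarrow> g j \<le> g (Suc j)) \<and> g K < n \<and> g (K + 1) < n"

lemma bval_valid_guess:
  "nvar s ''n'' = n \<Longrightarrow> bval p N (valid_guess K) s \<longleftrightarrow> valid (narr s ''g'')"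
  by (auto simp: valid_guess_def valid_def ball_Un not_less less_diff_conv)

definition scale :: "(nat \<Rightarrow> nat) \<Rightarrow> real" where
  "scale g = d (g K) (g (K + 1)) * real (g (K + 2)) / real M"

definition deadlines :: "real \<Rightarrow> real list" where
  "deadlines T = map (\<lambda>j. T * (real ((h + 1) ^ j) / real (h ^ j))) [0..<K]"

definition parent :: "(nat \<Rightarrow> nat) \<Rightarrow> nat list list \<Rightarrow> nat" where
  "parent g Ls = cheapest (\<lambda>i. length (Ls ! i) = g (K + 3) \<and> finish (Ls ! i) \<le> real \<beta> * scale g)
     (\<lambda>i. cost p (Ls ! i)) (length Ls)"

definition answer :: "(nat \<Rightarrow> nat) \<Rightarrow> nat list" where
  "answer g = A N (map g [0..<K]) (deadlines (scale g))"

definition new_labels :: "(nat \<Rightarrow> nat) \<Rightarrow> nat list list \<Rightarrow> nat list list" where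
  "new_labels g Ls = (if valid g
     then Ls @ [extend (g (K - 1)) (Ls ! parent g Ls) (answer g)] else Ls)"

text \<open>All stored labels lie below \<open>''top''\<close>, so that writing the next one cannot
  damage them.\<close>

definition holds :: "nat list list \<Rightarrow> state \<Rightarrow> bool" where
  "holds Ls t \<longleftrightarrow> nvar t ''labels'' = length Ls \<and> Ls \<noteq> [] \<and> (\<forall>i<length Ls. simple_route (Ls ! i) \<and>
     narr t ''len'' i = length (Ls ! i) \<and> narr t ''off'' i + length (Ls ! i) \<le> nvar t ''top'' \<and>
     (\<forall>j<length (Ls ! i). narr t ''heap'' (narr t ''off'' i + j) = Ls ! i ! j) \<and>
     rarr t ''costs'' i = cost p (Ls ! i) \<and> rarr t ''ends'' i = finish (Ls ! i))"

lemma wpE: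
  assumes "wp c Q s"
  obtains t m rs where "exec p K A N c s t m rs" "Q t m rs"
  using assms unfolding wp_def by blast

lemma holds_keeps:
  assumes "holds Ls s" "keeps X s t"
    and "X \<inter> {''labels'', ''len'', ''off'', ''top'', ''heap'', ''costs'', ''ends''} = {}"
  shows "holds Ls t"
proof -
  have "nvar t ''labels'' = nvar s ''labels''" "narr t ''len'' = narr s ''len''"
    "narr t ''off'' = narr s ''off''" "nvar t ''top'' = nvar s ''top''"
    "narr t ''heap'' = narr s ''heap''" "rarr t ''costs'' = rarr s ''costs''"
    "rarr t ''ends'' = rarr s ''ends''"
    using keepsD[OF assms(2)] assms(3) by auto
  with assms(1) show ?thesis by (simp add: holds_def)
qed

lemma wp_choose_label_holds:
  assumes "holds Ls s"
    and "\<And>t x. keeps {''best'', ''i''} s t \<Longrightarrow> bval p N (P (NVar x)) t \<longleftrightarrow> P' (nvar t x)"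
    and "\<And>i. i < length Ls \<Longrightarrow> P' i \<longleftrightarrow> P'' (Ls ! i)"
  shows "wp (choose_label P) (\<lambda>t m rs. rs = [] \<and> m \<le> 4 * length Ls + 3 \<and> keeps {''best'', ''i''} s t \<and>
    nvar t ''best'' = cheapest (\<lambda>i. P'' (Ls ! i)) (\<lambda>i. cost p (Ls ! i)) (length Ls)) s"
proof -
  have l: "nvar s ''labels'' = length Ls" using assms(1) by (simp add: holds_def)
  have eq: "cheapest P' (rarr s ''costs'') (length Ls) =
      cheapest (\<lambda>i. P'' (Ls ! i)) (\<lambda>i. cost p (Ls ! i)) (length Ls)"
    using assms(1,3) by (intro cheapest_cong) (auto simp: holds_def)
  show ?thesis using wp_choose_label[of s P P' "length Ls", OF assms(2) l] unfolding eq .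
qed

lemma nth_split: "i < length (xs @ [y]) \<Longrightarrow> (i < length xs \<and> (xs @ [y]) ! i = xs ! i) \<or>
    (i = length xs \<and> (xs @ [y]) ! i = y)"
  by (auto simp: nth_append)

text \<open>Deadlines are sorted because the scale is nonnegative and \<open>(h + 1) / h\<close> is
  at least 1; with scale 0 they all coincide.\<close>

lemma seg_instance_guess:
  assumes "valid g"
  shows "seg_instance N K (map g [0..<K]) (deadlines (scale g))"
proof -
  have "sorted (map g [0..<K])"
    unfolding sorted_iff_nth_Suc using assms by (auto simp: valid_def)
  moreover have "0 \<le> scale g"
    using assms by (auto simp: valid_def scale_def intro!: divide_nonneg_nonneg mult_nonneg_nonneg d_nonneg)
  then have "sorted (deadlines (scale g))"
    unfolding sorted_iff_nth_Suc deadlines_def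
    using h_pos by (auto intro!: mult_left_mono simp: divide_simps mult_le_cancel_left)
  ultimately show ?thesis
    using assms by (auto simp: seg_instance_def valid_def deadlines_def)
qed

text \<open>Nothing is assumed about \<open>A\<close>: that labels are simple routes with true costs
  survives any answer and any valid guess.\<close>

lemma wp_try_guess:
  assumes holds: "holds Ls s" and n: "nvar s ''n'' = n" and valid: "valid (narr s ''g'')"
  shows "wp (try_guess K h M \<beta>) (\<lambda>t m rs. length rs \<le> 1 \<and>
    m \<le> (4 * length Ls + 3 * n + K + 20) + (4 * n + 12) * answered rs \<and>
    nvar t ''n'' = n \<and> narr t ''g'' = narr s ''g'' \<and> holds (new_labels (narr s ''g'') Ls) t) s"
proof -
  define g where "g = narr s ''g''"
  define T where "T = scale g"
  let ?T = "RDivide (RTimes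
       (Dist (NArr ''g'' (Num K)) (NArr ''g'' (Num (K + 1)))) (OfNat (NArr ''g'' (Num (K + 2)))))
       (OfNat (Num M))"
  define s1 where "s1 = s\<lparr>rvar := (rvar s)(''T'' := rval p N ?T s)\<rparr>"
  have e1: "exec p K A N (RAssign ''T'' ?T) s s1 1 []"
    unfolding s1_def by (rule exec.RAssign)
  have k1: "keeps {''T''} s s1" by (simp add: s1_def keeps_agree)
  have T1: "rvar s1 ''T'' = T" by (simp add: s1_def T_def scale_def g_def)

  obtain s2 m2 where e2: "exec p K A N (set_deadlines h K) s1 s2 m2 []" and m2: "m2 \<le> K + 1"
    and k2: "keeps {''t''} s1 s2"
    and t2: "\<And>j. j < K \<Longrightarrow> rarr s2 ''t'' j = T * (real ((h + 1) ^ j) / real (h ^ j))"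
    by (rule wpE[OF wp_set_deadlines[of h K s1, unfolded T1]]) blast
  have holds2: "holds Ls s2"
    by (rule holds_keeps[OF holds_keeps[OF holds k1] k2]) simp_all

  let ?P = "\<lambda>e. Conj (NEq (NArr ''len'' e) (NArr ''g'' (Num (K + 3))))
       (Neg (RLess (RTimes (OfNat (Num \<beta>)) (RVar ''T'')) (RArr ''ends'' e)))"
  have g2: "narr s2 ''g'' = g" and T2: "rvar s2 ''T'' = T"
    using k1 k2 T1 by (simp_all add: keeps_def g_def)
  have P: "bval p N (?P (NVar x)) t \<longleftrightarrow>
      narr s2 ''len'' (nvar t x) = g (K + 3) \<and> rarr s2 ''ends'' (nvar t x) \<le> real \<beta> * T"
    if "keeps {''best'', ''i''} s2 t" for t x
  proof -
    have "narr t ''len'' = narr s2 ''len''" "narr t ''g'' = g" "rvar t ''T'' = T"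
      "rarr t ''ends'' = rarr s2 ''ends''"
      using that g2 T2 by (simp_all add: keeps_def)
    then show ?thesis by auto
  qed
  have choose: "wp (choose_label ?P) (\<lambda>t m rs. rs = [] \<and> m \<le> 4 * length Ls + 3 \<and>
      keeps {''best'', ''i''} s2 t \<and> nvar t ''best'' = parent g Ls) s2"
    unfolding parent_def T_def[symmetric]
    by (rule wp_choose_label_holds[OF holds2 P, where P'' = "\<lambda>zs. length zs = g (K + 3) \<and> finish zs \<le> real \<beta> * T"])
      (use holds2 in \<open>simp_all add: holds_def\<close>)
  obtain s3 m3 where e3: "exec p K A N (choose_label ?P) s2 s3 m3 []"
    and m3: "m3 \<le> 4 * length Ls + 3" and k3: "keeps {''best'', ''i''} s2 s3"
    and best3: "nvar s3 ''best'' = parent g Ls"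
    by (rule wpE[OF choose]) blast
  have holds3: "holds Ls s3" by (rule holds_keeps[OF holds2 k3]) simp
  define zs where "zs = Ls ! parent g Ls"
  have "0 < length Ls" using holds by (simp add: holds_def)
  then have parent: "parent g Ls < length Ls" unfolding parent_def by (rule cheapest_less)
  have zs: "simple_route zs" using holds parent by (simp add: holds_def zs_def)
  have g3: "narr s3 ''g'' = g" and n3: "nvar s3 ''n'' = n"
    using k1 k2 k3 n by (simp_all add: keeps_def g_def)

  define xs where "xs = answer g"
  have ns: "map (narr s3 ''g'') [0..<K] = map g [0..<K]" by (simp add: g3)
  have "rarr s3 ''t'' j = rarr s2 ''t'' j" for j using k3 by (simp add: keeps_def)
  then have ts: "map (rarr s3 ''t'') [0..<K] = deadlines (scale g)"
    unfolding deadlines_def using t2 by (auto simp: T_def)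
  define s4 where "s4 = s3\<lparr>nvar := (nvar s3)(''l'' := length xs),
         narr := (narr s3)(''ans'' := (\<lambda>i. if i < length xs then xs ! i else narr s3 ''ans'' i))\<rparr>"
  have e4: "exec p K A N (Call ''g'' ''t'' ''ans'' ''l'') s3 s4 1 [xs]"
    unfolding s4_def
    by (rule exec.Call[OF refl refl])
      (use seg_instance_guess valid in \<open>simp_all add: ns ts xs_def answer_def g_def\<close>)
  have k4: "keeps {''l'', ''ans''} s3 s4" by (simp add: s4_def keeps_agree)
  have holds4: "holds Ls s4" by (rule holds_keeps[OF holds3 k4]) simp

  define s5 where "s5 = s4\<lparr>nvar := (nvar s4)(''m'' := nval (NArr ''len'' (NVar ''best'')) s4)\<rparr>"
  have e5: "exec p K A N (NAssign ''m'' (NArr ''len'' (NVar ''best''))) s4 s5 1 []"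
    unfolding s5_def by (rule exec.NAssign)
  define s6 where "s6 = s5\<lparr>rvar := (rvar s5)(''cost'' := rval p N (RArr ''costs'' (NVar ''best'')) s5)\<rparr>"
  have e6: "exec p K A N (RAssign ''cost'' (RArr ''costs'' (NVar ''best''))) s5 s6 1 []"
    unfolding s6_def by (rule exec.RAssign)
  define s7 where "s7 = s6\<lparr>rvar := (rvar s6)(''now'' := rval p N (RArr ''ends'' (NVar ''best'')) s6)\<rparr>"
  have e7: "exec p K A N (RAssign ''now'' (RArr ''ends'' (NVar ''best''))) s6 s7 1 []"
    unfolding s7_def by (rule exec.RAssign)
  have k7: "keeps {''m'', ''cost'', ''now''} s4 s7"
    by (simp add: s5_def s6_def s7_def keeps_agree)
  have holds7: "holds Ls s7" by (rule holds_keeps[OF holds4 k7]) simp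
  have best4: "nvar s4 ''best'' = parent g Ls" using k4 best3 by (simp add: keeps_def)
  have cur7: "nvar s7 ''m'' = length zs" "rvar s7 ''cost'' = cost p zs" "rvar s7 ''now'' = finish zs"
    using holds4 parent by (simp_all add: s5_def s6_def s7_def best4 holds_def zs_def)
  have best7: "nvar s7 ''best'' = parent g Ls" using k7 best4 by (simp add: keeps_def)
  define off where "off = narr s7 ''off'' (parent g Ls)"
  have off: "off + length zs \<le> nvar s7 ''top''"
    "\<And>j. j < length zs \<Longrightarrow> narr s7 ''heap'' (off + j) = zs ! j"
    using holds7 parent by (simp_all add: holds_def off_def zs_def)

  have top: "nval (NVar ''top'') t = nvar s7 ''top''"
    and len: "nval (NVar ''m'') t = length zs" if "keeps {''i'', ''heap''} s7 t" for t
    using that cur7(1) by (simp_all add: keeps_def)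
  have best_off: "narr s7 ''off'' (nvar s7 ''best'') = off" by (simp only: best7 off_def)
  have below_top: "''heap'' = ''heap'' \<and> off + length zs \<le> nvar s7 ''top'' \<or> ''heap'' = ''out''"
    using off(1) by blast
  obtain s8 m8 rs8 where "exec p K A N (copy_label ''heap'' (NVar ''top'') (NVar ''m'')) s7 s8 m8 rs8"
    and s8: "rs8 = [] \<and> m8 \<le> 3 * length zs + 2 \<and> keeps {''i'', ''heap''} s7 s8 \<and>
      (\<forall>i<length zs. narr s8 ''heap'' (nvar s7 ''top'' + i) = narr s7 ''heap'' (off + i)) \<and>
      (\<forall>x<nvar s7 ''top''. narr s8 ''heap'' x = narr s7 ''heap'' x)"
    by (rule wpE[OF wp_copy_label[OF top len best_off below_top]])
  then have e8: "exec p K A N (copy_label ''heap'' (NVar ''top'') (NVar ''m'')) s7 s8 m8 []"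
    by simp
  have m8: "m8 \<le> 3 * length zs + 2" and k8: "keeps {''i'', ''heap''} s7 s8"
    and heap8: "\<And>i. i < length zs \<Longrightarrow> narr s8 ''heap'' (nvar s7 ''top'' + i) = narr s7 ''heap'' (off + i)"
      "\<And>x. x < nvar s7 ''top'' \<Longrightarrow> narr s8 ''heap'' x = narr s7 ''heap'' x"
    using s8 by simp_all
  have cur8: "current zs s8"
    using k8 cur7 heap8(1) off(2) by (simp add: current_def keeps_def)
  have k48: "keeps {''i'', ''heap'', ''m'', ''cost'', ''now''} s4 s8"
    by (rule keeps_trans[OF k7 k8]) simp_all
  have top8: "nvar s8 ''top'' = nvar s7 ''top''" using k8 by (simp add: keeps_def)
  have n8: "nvar s8 ''n'' = n" and g8: "narr s8 ''g'' = g"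
    using k48 k4 n3 g3 by (simp_all add: keeps_def)
  have l8: "nvar s8 ''l'' = length xs" and ans8: "\<And>j. j < length xs \<Longrightarrow> narr s8 ''ans'' j = xs ! j"
    using k48 by (simp_all add: keeps_def s4_def)

  define zs' where "zs' = extend (g (K - 1)) zs xs"
  let ?X = "{''i'', ''j'', ''found'', ''now'', ''cost'', ''heap'', ''m''}"
  obtain s9 m9 rs9 where "exec p K A N (extend_label K) s8 s9 m9 rs9"
    and s9: "rs9 = [] \<and> m9 \<le> length xs * (4 * n + 12) + 2 \<and> keeps ?X s8 s9 \<and> current zs' s9 \<and>
      (\<forall>x<nvar s7 ''top''. narr s9 ''heap'' x = narr s8 ''heap'' x)"
    unfolding zs'_def by (rule wpE[OF wp_extend_label[OF cur8 zs n8 l8 ans8, unfolded g8 top8]])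
  then have e9: "exec p K A N (extend_label K) s8 s9 m9 []" by simp
  have m9: "m9 \<le> length xs * (4 * n + 12) + 2" and k9: "keeps ?X s8 s9" and cur9: "current zs' s9"
    and heap9: "\<And>x. x < nvar s7 ''top'' \<Longrightarrow> narr s9 ''heap'' x = narr s8 ''heap'' x"
    using s9 by simp_all
  have k79: "keeps ?X s7 s9" by (rule keeps_trans[OF k8 k9]) simp_all
  have zs': "simple_route zs'" unfolding zs'_def using zs by (rule extend_simple)

  obtain s10 where e10: "exec p K A N add_label s9 s10 6 []"
    and k10: "keeps {''off'', ''len'', ''costs'', ''ends'', ''top'', ''labels''} s9 s10"
    and add: "narr s10 ''off'' = (narr s9 ''off'')(nvar s9 ''labels'' := nvar s9 ''top'')"
      "narr s10 ''len'' = (narr s9 ''len'')(nvar s9 ''labels'' := nvar s9 ''m'')"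
      "rarr s10 ''costs'' = (rarr s9 ''costs'')(nvar s9 ''labels'' := rvar s9 ''cost'')"
      "rarr s10 ''ends'' = (rarr s9 ''ends'')(nvar s9 ''labels'' := rvar s9 ''now'')"
      "nvar s10 ''top'' = nvar s9 ''top'' + nvar s9 ''m''"
      "nvar s10 ''labels'' = Suc (nvar s9 ''labels'')"
    by (rule wpE[OF wp_add_label[of s9]]) blast
  have eqs9: "nvar s9 ''labels'' = length Ls" "nvar s9 ''top'' = nvar s7 ''top''"
    "narr s9 ''off'' = narr s7 ''off''" "narr s9 ''len'' = narr s7 ''len''"
    "rarr s9 ''costs'' = rarr s7 ''costs''" "rarr s9 ''ends'' = rarr s7 ''ends''"
    using k79 holds7 by (simp_all add: keeps_def holds_def)
  have heap: "narr s10 ''heap'' = narr s9 ''heap''" using k10 by (simp add: keeps_def)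
  have "holds (Ls @ [zs']) s10"
    unfolding holds_def
  proof (intro conjI allI impI)
    show "nvar s10 ''labels'' = length (Ls @ [zs'])" by (simp add: add eqs9)
    show "Ls @ [zs'] \<noteq> []" by simp
    fix i assume i: "i < length (Ls @ [zs'])"
    note split = nth_split[OF i]
    show "simple_route ((Ls @ [zs']) ! i)"
      using split holds7 zs' by (auto simp: holds_def)
    show "narr s10 ''len'' i = length ((Ls @ [zs']) ! i)"
      using split holds7 cur9 by (auto simp: holds_def add eqs9 current_def)
    show "narr s10 ''off'' i + length ((Ls @ [zs']) ! i) \<le> nvar s10 ''top''"
      using split holds7 cur9 by (auto simp: holds_def add eqs9 current_def trans_le_add1)
    show "rarr s10 ''costs'' i = cost p ((Ls @ [zs']) ! i)"
      using split holds7 cur9 by (auto simp: holds_def add eqs9 current_def)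
    show "rarr s10 ''ends'' i = finish ((Ls @ [zs']) ! i)"
      using split holds7 cur9 by (auto simp: holds_def add eqs9 current_def)
    fix j assume j: "j < length ((Ls @ [zs']) ! i)"
    show "narr s10 ''heap'' (narr s10 ''off'' i + j) = (Ls @ [zs']) ! i ! j"
      using split
    proof
      assume i: "i < length Ls \<and> (Ls @ [zs']) ! i = Ls ! i"
      then have "narr s7 ''off'' i + length (Ls ! i) \<le> nvar s7 ''top''"
        "narr s7 ''heap'' (narr s7 ''off'' i + j) = Ls ! i ! j"
        using holds7 j by (simp_all add: holds_def)
      moreover have "narr s10 ''off'' i = narr s7 ''off'' i" using i by (simp add: add eqs9)
      ultimately show ?thesis using i j by (simp add: heap heap9 heap8(2))
    next
      assume "i = length Ls \<and> (Ls @ [zs']) ! i = zs'"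
      then show ?thesis using j cur9 by (simp add: heap add eqs9 current_def)
    qed
  qed
  moreover have "new_labels g Ls = Ls @ [zs']"
    using valid by (simp add: new_labels_def g_def zs'_def zs_def xs_def)
  moreover have "nvar s10 ''n'' = n" "narr s10 ''g'' = g"
    using n8 g8 k9 k10 by (simp_all add: keeps_def)
  moreover have "exec p K A N (try_guess K h M \<beta>) s s10
      (1 + (m2 + (m3 + (1 + (1 + (1 + (1 + (m8 + (m9 + 6)))))))))
      ([] @ [] @ [] @ [xs] @ [] @ [] @ [] @ [] @ [] @ [])"
    unfolding try_guess_def
    by (intro exec.Seq[OF e1] exec.Seq[OF e2] exec.Seq[OF e3] exec.Seq[OF e4] exec.Seq[OF e5]
        exec.Seq[OF e6] exec.Seq[OF e7] exec.Seq[OF e8] exec.Seq[OF e9] e10)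
  moreover have "1 + (m2 + (m3 + (1 + (1 + (1 + (1 + (m8 + (m9 + 6)))))))) \<le>
      (4 * length Ls + 3 * n + K + 20) + (4 * n + 12) * answered [xs]"
    using m2 m3 m8 m9 simple_route_length[OF zs] by (simp add: mult.commute)
  ultimately show ?thesis unfolding wp_def g_def by fastforce
qed


section \<open>Enumeration of the guesses\<close>

definition base :: nat where
  "base = M * (n + 1)"

definition digit :: "nat \<Rightarrow> nat \<Rightarrow> nat" where
  "digit m j = m div base ^ j mod base"

primrec labels :: "nat \<Rightarrow> nat list list" where
  "labels 0 = [[source N]]"
| "labels (Suc m) = new_labels (digit m) (labels m)"

lemma base_pos: "0 < base"
  using M_pos by (simp add: base_def)

lemma length_labels: "length (labels m) \<le> Suc m"
  by (induction m) (auto simp: new_labels_def)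

text \<open>Entry \<open>K + 4\<close> of the array counts the rounds, whereas
  \<open>digit m\<close> is reduced modulo \<open>base\<close> there; a guess reads only the entries
  before it.\<close>

lemma new_labels_cong:
  assumes "\<And>j. j < K + 4 \<Longrightarrow> g j = g' j"
  shows "new_labels g Ls = new_labels g' Ls"
proof -
  have "valid g \<longleftrightarrow> valid g'" "scale g = scale g'" "g (K + 3) = g' (K + 3)" "g (K - 1) = g' (K - 1)"
    using assms by (simp_all add: valid_def scale_def)
  moreover have "map g [0..<K] = map g' [0..<K]" using assms by simp
  ultimately show ?thesis by (simp only: new_labels_def parent_def answer_def)
qed

definition iteration_count :: nat where
  "iteration_count = n * base ^ (K + 4)"

definition invariant :: "nat \<Rightarrow> state \<Rightarrow> bool" where
  "invariant m t \<longleftrightarrow> nvar t ''n'' = n \<and> (\<forall>j<K + 4. narr t ''g'' j = digit m j) \<and>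
     narr t ''g'' (K + 4) = m div base ^ (K + 4) \<and> holds (labels m) t"

lemma wp_iteration:
  assumes inv: "invariant m s" and m: "m < iteration_count"
  shows "wp (iteration K h M \<beta>) (\<lambda>t m' rs. invariant (Suc m) t \<and> length rs \<le> 1 \<and>
    m' \<le> (4 * iteration_count + 3 * n + 5 * K + 40) + (4 * n + 12) * answered rs) s"
proof -
  let ?g = "narr s ''g''"
  have s: "nvar s ''n'' = n" "holds (labels m) s" using inv by (simp_all add: invariant_def)
  have len: "length (labels m) \<le> iteration_count" using length_labels[of m] m by simp
  have labels: "labels (Suc m) = new_labels ?g (labels m)"
    using inv by (auto simp: invariant_def intro: new_labels_cong)
  let ?Q = "\<lambda>t m' rs. length rs \<le> 1 \<and>
    m' \<le> (4 * iteration_count + 3 * n + K + 22) + (4 * n + 12) * answered rs \<and>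
    nvar t ''n'' = n \<and> narr t ''g'' = ?g \<and> holds (labels (Suc m)) t"
  have guess: "wp (If (valid_guess K) (try_guess K h M \<beta>) Skip) ?Q s"
  proof (cases "valid ?g")
    case True
    have "wp (try_guess K h M \<beta>) (\<lambda>t m'. ?Q t (Suc m')) s"
      by (rule wp_mono[OF wp_try_guess[OF s(2,1) True]]) (use len in \<open>auto simp: labels simp del: labels.simps\<close>)
    then show ?thesis using bval_valid_guess[OF s(1)] True by simp
  next
    case False
    then show ?thesis
      using bval_valid_guess[OF s(1)] s by (simp add: labels new_labels_def del: labels.simps)
  qed
  have incr: "wp (increment M (K + 4) 0) (\<lambda>t' m'' rs'. invariant (Suc m) t' \<and> rs' = [] \<and>
      m'' \<le> 4 * (K + 4) + 1) t"
    if "nvar t ''n'' = n" "narr t ''g'' = ?g" "holds (labels (Suc m)) t" for t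
  proof -
    have digits: "narr t ''g'' (0 + i) = m div base ^ i mod base" if "i < K + 4" for i
      using that inv \<open>narr t ''g'' = ?g\<close> by (simp add: invariant_def digit_def)
    have top: "narr t ''g'' (0 + (K + 4)) = m div base ^ (K + 4)"
      using inv that by (simp add: invariant_def)
    show ?thesis
    proof (rule wp_mono[OF wp_increment[OF that(1) base_def base_pos digits top]])
      fix t' and m'' :: nat and rs' :: "nat list list"
      assume *: "rs' = [] \<and> m'' \<le> 4 * (K + 4) + 1 \<and> keeps {''g''} t t' \<and>
        (\<forall>i<0. narr t' ''g'' i = narr t ''g'' i) \<and>
        (\<forall>i<K + 4. narr t' ''g'' (0 + i) = Suc m div base ^ i mod base) \<and>
        narr t' ''g'' (0 + (K + 4)) = Suc m div base ^ (K + 4)"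
      then have keeps: "keeps {''g''} t t'" by simp
      have "nvar t' ''n'' = n" using keeps that(1) by (simp add: keeps_def)
      moreover have "holds (labels (Suc m)) t'" by (rule holds_keeps[OF that(3) keeps]) simp
      ultimately show "invariant (Suc m) t' \<and> rs' = [] \<and> m'' \<le> 4 * (K + 4) + 1"
        using * by (simp add: invariant_def digit_def)
    qed
  qed
  have "wp (If (valid_guess K) (try_guess K h M \<beta>) Skip) (\<lambda>t m' rs.
      wp (increment M (K + 4) 0) (\<lambda>t' m'' rs'. invariant (Suc m) t' \<and> length (rs @ rs') \<le> 1 \<and>
        m' + m'' \<le> (4 * iteration_count + 3 * n + 5 * K + 40) + (4 * n + 12) * answered (rs @ rs')) t) s"
  proof (rule wp_mono[OF guess], elim conjE)
    fix t and m' :: nat and rs :: "nat list list"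
    assume *: "length rs \<le> 1"
      "m' \<le> (4 * iteration_count + 3 * n + K + 22) + (4 * n + 12) * answered rs"
      "nvar t ''n'' = n" "narr t ''g'' = ?g" "holds (labels (Suc m)) t"
    show "wp (increment M (K + 4) 0) (\<lambda>t' m'' rs'. invariant (Suc m) t' \<and> length (rs @ rs') \<le> 1 \<and>
        m' + m'' \<le> (4 * iteration_count + 3 * n + 5 * K + 40) + (4 * n + 12) * answered (rs @ rs')) t"
      by (rule wp_mono[OF incr[OF *(3-5)]]) (use *(1,2) in auto)
  qed
  then show ?thesis unfolding iteration_def by (simp del: wp_If labels.simps)
qed

lemma wp_initialise:
  "wp initialise (\<lambda>t m rs. rs = [] \<and> m = 4 \<and> invariant 0 t) (initial_state N)"
proof -
  have "simple_route [source N]"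
    using source_less by (simp add: simple_route_def route_def verts_def)
  \<comment> \<open>The cells 0 of \<open>''off''\<close>, \<open>''costs''\<close> and
    \<open>''ends''\<close> are not written by \<open>initialise\<close>: their initial value 0 is
    right for the label \<open>[source N]\<close>.\<close>
  moreover have "0 < K" "\<bar>0::real\<bar> powr p = 0" by (simp_all add: K_pos)
  ultimately show ?thesis
    by (simp add: initialise_def initial_state_def invariant_def digit_def holds_def cost_def
        finish_def)
qed

lemma wp_main_loop:
  assumes "invariant 0 s"
  shows "wp (While (NLess (NArr ''g'' (Num (K + 4))) (NVar ''n'')) (iteration K h M \<beta>))
    (\<lambda>t m rs. invariant iteration_count t \<and> length rs \<le> iteration_count \<and>
      m \<le> iteration_count * (4 * iteration_count + 3 * n + 5 * K + 41) + 1 + (4 * n + 12) * answered rs) s"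
proof (rule wp_While_for[where n = iteration_count and I = invariant and \<kappa> = 1 and
      \<tau> = "4 * iteration_count + 3 * n + 5 * K + 40" and \<rho> = "4 * n + 12"])
  have cond: "bval p N (NLess (NArr ''g'' (Num (K + 4))) (NVar ''n'')) t \<longleftrightarrow> i div base ^ (K + 4) < n"
    if "invariant i t" for i t
    using that by (simp add: invariant_def)
  show "\<not> bval p N (NLess (NArr ''g'' (Num (K + 4))) (NVar ''n'')) t"
    if "invariant iteration_count t" for t
    unfolding cond[OF that] using base_pos by (simp add: iteration_count_def)
  fix i t
  assume i: "i < iteration_count" and inv: "invariant i t"
  have "i div base ^ (K + 4) < n"
    using i base_pos by (intro div_less_iff_less_mult[THEN iffD2]) (simp_all add: iteration_count_def)
  with cond[OF inv] wp_iteration[OF inv i]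
  show "bval p N (NLess (NArr ''g'' (Num (K + 4))) (NVar ''n'')) t \<and>
    wp (iteration K h M \<beta>) (\<lambda>t' m rs. invariant (Suc i) t' \<and> length rs \<le> 1 \<and>
      m \<le> (4 * iteration_count + 3 * n + 5 * K + 40) + (4 * n + 12) * answered rs) t" by blast
qed (use assms in \<open>auto simp: algebra_simps\<close>)

text \<open>The output is a cheapest complete label. The analysis may therefore compare it with
  whichever complete label \<open>zs\<close> it can construct.\<close>

lemma wp_lp_program:
  assumes zs: "zs \<in> set (labels iteration_count)" "length zs = n"
  shows "wp (lp_program K h M \<beta>) (\<lambda>t m rs. feasible_route N (result N t) \<and>
    cost p (result N t) \<le> cost p zs \<and> length rs \<le> iteration_count \<and>
    m \<le> (iteration_count + 1) * (4 * iteration_count + 3 * n + 5 * K + 41) + 15 + (4 * n + 12) * answered rs)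
    (initial_state N)"
proof -
  obtain s1 m1 rs1 where "exec p K A N initialise (initial_state N) s1 m1 rs1"
    and s1: "rs1 = [] \<and> m1 = 4 \<and> invariant 0 s1"
    by (rule wpE[OF wp_initialise])
  then have e1: "exec p K A N initialise (initial_state N) s1 4 []" by simp
  let ?loop = "While (NLess (NArr ''g'' (Num (K + 4))) (NVar ''n'')) (iteration K h M \<beta>)"
  obtain s2 m2 rs2 where e2: "exec p K A N ?loop s1 s2 m2 rs2"
    and s2: "invariant iteration_count s2 \<and> length rs2 \<le> iteration_count \<and>
      m2 \<le> iteration_count * (4 * iteration_count + 3 * n + 5 * K + 41) + 1 + (4 * n + 12) * answered rs2"
    using wpE[OF wp_main_loop] s1 by blast
  let ?Ls = "labels iteration_count"
  define b where "b = cheapest (\<lambda>i. length (?Ls ! i) = n) (\<lambda>i. cost p (?Ls ! i)) (length ?Ls)"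
  have holds2: "holds ?Ls s2" and n2: "nvar s2 ''n'' = n"
    using s2 by (simp_all add: invariant_def)
  let ?P = "\<lambda>e. NEq (NArr ''len'' e) (NVar ''n'')"
  have P: "bval p N (?P (NVar x)) t \<longleftrightarrow> narr s2 ''len'' (nvar t x) = n"
    if "keeps {''best'', ''i''} s2 t" for t x
  proof -
    have "narr t ''len'' = narr s2 ''len''" "nvar t ''n'' = n"
      using that n2 by (simp_all add: keeps_def)
    then show ?thesis by auto
  qed
  have P': "narr s2 ''len'' i = n \<longleftrightarrow> length (?Ls ! i) = n" if "i < length ?Ls" for i
    using holds2 that by (simp add: holds_def)
  obtain s3 m3 rs3 where "exec p K A N (choose_label ?P) s2 s3 m3 rs3"
    and s3: "rs3 = [] \<and> m3 \<le> 4 * length ?Ls + 3 \<and> keeps {''best'', ''i''} s2 s3 \<and> nvar s3 ''best'' = b"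
    unfolding b_def
    by (rule wpE[OF wp_choose_label_holds[where P'' = "\<lambda>zs. length zs = n", OF holds2 P P']])
  then have e3: "exec p K A N (choose_label ?P) s2 s3 m3 []" by simp
  have holds3: "holds ?Ls s3" by (rule holds_keeps[OF holds2]) (use s3 in auto)
  have n3: "nvar s3 ''n'' = n" using s3 n2 by (simp add: keeps_def)
  obtain i where "i < length ?Ls" "?Ls ! i = zs" using zs(1) by (auto simp: in_set_conv_nth)
  with zs(2) have "length (?Ls ! b) = n \<and> cost p (?Ls ! b) \<le> cost p zs"
    unfolding b_def using cheapest_min[of i "length ?Ls" "\<lambda>i. length (?Ls ! i) = n" "\<lambda>i. cost p (?Ls ! i)"]
    by simp
  moreover have b: "b < length ?Ls"
    unfolding b_def by (rule cheapest_less) (use holds2 in \<open>simp add: holds_def\<close>)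
  ultimately have best: "simple_route (?Ls ! b)" "length (?Ls ! b) = n" "cost p (?Ls ! b) \<le> cost p zs"
    and heap: "\<And>j. j < n \<Longrightarrow> narr s3 ''heap'' (narr s3 ''off'' b + j) = ?Ls ! b ! j"
    using holds3 by (simp_all add: holds_def)
  have off: "narr s3 ''off'' (nvar s3 ''best'') = narr s3 ''off'' b" using s3 by simp
  have out: "''out'' = ''heap'' \<and> narr s3 ''off'' b + n \<le> 0 \<or> ''out'' = ''out''" by blast
  have zero: "nval (Num 0) t = 0" and n: "nval (NVar ''n'') t = n"
    if "keeps {''i'', ''out''} s3 t" for t
    using that n3 by (simp_all add: keeps_def)
  obtain s4 m4 rs4 where "exec p K A N (copy_label ''out'' (Num 0) (NVar ''n'')) s3 s4 m4 rs4"
    and s4: "rs4 = [] \<and> m4 \<le> 3 * n + 2 \<and> keeps {''i'', ''out''} s3 s4 \<and>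
      (\<forall>i<n. narr s4 ''out'' (0 + i) = narr s3 ''heap'' (narr s3 ''off'' b + i)) \<and>
      (\<forall>x<0. narr s4 ''out'' x = narr s3 ''out'' x)"
    by (rule wpE[OF wp_copy_label[OF zero n off out]])
  then have e4: "exec p K A N (copy_label ''out'' (Num 0) (NVar ''n'')) s3 s4 m4 []" by simp
  have "result N s4 = ?Ls ! b"
    using s4 heap best(2) by (intro nth_equalityI) (simp_all add: result_def)
  then have "feasible_route N (result N s4)" "cost p (result N s4) \<le> cost p zs"
    using best by (simp_all add: feasible_route_iff)
  moreover have "exec p K A N (lp_program K h M \<beta>) (initial_state N) s4
      (4 + (m2 + (m3 + m4))) ([] @ rs2 @ [] @ [])"
    unfolding lp_program_def by (intro exec.Seq[OF e1] exec.Seq[OF e2] exec.Seq[OF e3] e4)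
  moreover have "4 + (m2 + (m3 + m4)) \<le>
      (iteration_count + 1) * (4 * iteration_count + 3 * n + 5 * K + 41) + 15 + (4 * n + 12) * answered rs2"
    using s2 s3 s4 length_labels[of iteration_count] by (simp add: algebra_simps)
  ultimately show ?thesis unfolding wp_def using s2
    by (metis append.left_neutral append.right_neutral)
qed

end

section \<open>Chunks of an optimal tour\<close>

lemma digits_exist:
  fixes B :: nat
  assumes "0 < B" "\<And>j. j < D \<Longrightarrow> g j < B"
  shows "\<exists>m < B ^ D. \<forall>j<D. m div B ^ j mod B = g j"
  using assms(2)
proof (induction D arbitrary: g)
  case (Suc D)
  from Suc.IH[of "\<lambda>j. g (Suc j)"] Suc.prems obtain m where
    m: "m < B ^ D" "\<And>j. j < D \<Longrightarrow> m div B ^ j mod B = g (Suc j)" by auto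
  have g0: "g 0 < B" using Suc.prems by simp
  show ?case
  proof (intro exI conjI allI impI)
    have "g 0 + B * m < B * Suc m" using g0 by simp
    also have "\<dots> \<le> B * B ^ D" using m(1) by (intro mult_le_mono2) simp
    finally show "g 0 + B * m < B ^ Suc D" by simp
    show "(g 0 + B * m) div B ^ j mod B = g j" if "j < Suc D" for j
      using that g0 m(2) by (cases j) (simp_all add: div_mult2_eq)
  qed
qed simp

text \<open>Members of one residue class differ by a multiple of \<open>k\<close>, so a difference
  above \<open>- k\<close> is nonnegative. Cut exponents are compared in this way.\<close>

lemma cong_gap:
  fixes u v k :: int
  assumes "(u - c) mod k = 0" "(v - c) mod k = 0" "v - k < u" "0 < k"
  shows "v \<le> u"
proof -
  have "k dvd (u - c) - (v - c)" by (rule dvd_diff) (use assms(1,2) in \<open>simp_all add: mod_eq_0_iff_dvd\<close>)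
  then obtain w where w: "u - v = k * w" by (auto simp: dvd_def)
  with assms(3,4) have "k * (- 1) < k * w" by simp
  with assms(4) have "- 1 < w" by (simp only: mult_less_cancel_left_pos)
  with w assms(4) have "0 \<le> u - v" by simp
  then show ?thesis by simp
qed

text \<open>The last deadline \<open>T * q ^ (k + 1)\<close> has to reach the end of the chunk
  although \<open>T\<close> may be almost a factor \<open>q\<close> below its start; this is why
  \<open>K = k + 2\<close>. An integer \<open>\<beta>\<close> between \<open>8 * \<alpha>\<close>
  and \<open>9 * \<alpha>\<close> exists since \<open>1 \<le> \<alpha>\<close>. The bound on
  \<open>k\<close> makes the averaged delay of the \<open>p\<close>-th powers a fraction of at most
  \<open>1 / h\<close>.\<close>

locale reduction = program p K A N h M \<beta> for p K A N h M \<beta> +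
  fixes k :: nat and \<alpha> :: real
  assumes p: "1 \<le> p" and K: "K = k + 2" and M: "M = (h + 1) * 2 ^ k"
    and seg: "seg_approx_algorithm \<alpha> K A" and \<alpha>: "1 \<le> \<alpha>"
    and \<beta>: "8 * \<alpha> \<le> real \<beta>" "real \<beta> \<le> 9 * \<alpha>" and k: "2 * 19 powr p * (real h)\<^sup>2 \<le> real k"
begin

definition q :: real where
  "q = real (h + 1) / real h"

lemma q_eq: "q = 1 + 1 / real h"
  using h_pos by (simp add: q_def field_simps)

lemma q_gt_1: "1 < q"
  using h_pos by (simp add: q_eq)

lemma q_le_2: "q \<le> 2"
  using h_pos by (simp add: q_eq)

lemma k_pos: "0 < k"
  and k_ge: "3 * h + 1 \<le> k"
proof -
  have h: "1 \<le> real h" using h_pos by simp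
  have "19 powr 1 \<le> (19::real) powr p" using p by (intro powr_mono) simp_all
  then have "38 * (real h)\<^sup>2 \<le> (2 * 19 powr p) * (real h)\<^sup>2" by (intro mult_right_mono) simp_all
  moreover have "real h * 1 \<le> real h * real h" using h by (intro mult_left_mono) simp_all
  then have "real h \<le> (real h)\<^sup>2" by (simp add: power2_eq_square)
  ultimately have "real (3 * h + 1) \<le> real k" using k h by linarith
  then show "3 * h + 1 \<le> k" by linarith
  then show "0 < k" by simp
qed

text \<open>Bernoulli's inequality with \<open>k - 1 \<ge> 3 * h\<close>. The factor 4 makes twice
  the start of a chunk at most half of \<open>q powi (G' + k - 1)\<close>, which absorbs the return
  trip.\<close>

lemma four_le_q_power: "4 \<le> q ^ (k - 1)"
proof -
  have "real (3 * h) * (1 / real h) \<le> real (k - 1) * (1 / real h)"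
    using k_ge by (intro mult_right_mono) auto
  moreover have "1 + real (k - 1) * (1 / real h) \<le> q ^ (k - 1)"
    unfolding q_eq by (intro Bernoulli_inequality) (simp add: order_trans[of "-1" 0])
  moreover have "real (3 * h) * (1 / real h) = 3" using h_pos by simp
  ultimately show ?thesis by linarith
qed

lemma deadlines_eq: "deadlines T = map (\<lambda>j. T * q ^ j) [0..<K]"
  by (simp add: deadlines_def q_def power_divide)

lemma labels_mono: "m \<le> m' \<Longrightarrow> set (labels m) \<subseteq> set (labels m')"
proof (induction m' rule: dec_induct)
  case (step m')
  then show ?case by (auto simp: new_labels_def)
qed simp

lemma labels_nonempty: "labels m \<noteq> []"
  by (induction m) (auto simp: new_labels_def)

lemma labels_simple: "zs \<in> set (labels m) \<Longrightarrow> simple_route zs"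
proof (induction m arbitrary: zs)
  case 0
  then show ?case using source_less by (simp add: simple_route_def route_def verts_def)
next
  case (Suc m)
  have "parent (digit m) (labels m) < length (labels m)"
    unfolding parent_def using labels_nonempty by (intro cheapest_less) simp
  with Suc show ?case by (auto simp: new_labels_def intro!: extend_simple split: if_splits)
qed

definition round_length :: nat where
  "round_length = base ^ (K + 4)"

text \<open>A multiple of \<open>round_length\<close> does not affect the low \<open>K + 4\<close>
  digits, so every guess recurs in every round.\<close>

lemma digit_in_round:
  assumes "\<And>j. j < K + 4 \<Longrightarrow> g j < base"
  obtains m where "r * round_length \<le> m" "m < Suc r * round_length"
    "\<And>j. j < K + 4 \<Longrightarrow> digit m j = g j"
proof -
  have "\<exists>c<base ^ (K + 4). \<forall>j<K + 4. c div base ^ j mod base = g j"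
    by (rule digits_exist[OF base_pos assms])
  then obtain c where c: "c < base ^ (K + 4)" "\<And>j. j < K + 4 \<Longrightarrow> c div base ^ j mod base = g j"
    by blast
  have "digit (r * round_length + c) j = g j" if j: "j < K + 4" for j
  proof -
    have "round_length = base ^ (j + Suc (K + 4 - Suc j))"
      unfolding round_length_def using j by (intro arg_cong[where f = "power base"]) simp
    then have "round_length = base ^ j * (base * base ^ (K + 4 - Suc j))"
      by (simp only: power_add power_Suc)
    then have eq: "r * round_length + c = c + base ^ j * (base * (base ^ (K + 4 - Suc j) * r))"
      by (simp only: ac_simps)
    have "(r * round_length + c) div base ^ j = c div base ^ j + base * (base ^ (K + 4 - Suc j) * r)"
      unfolding eq using base_pos by simp
    then show ?thesis using c(2)[OF j] by (simp add: digit_def)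
  qed
  then show ?thesis using that[of "r * round_length + c"] c(1) by (simp add: round_length_def)
qed

text \<open>One round of the program finds the best extension of a label by one chunk of the tour.\<close>

lemma extend_by_chunk:
  assumes zs: "zs \<in> set (labels (r * round_length))" "finish zs \<le> real \<beta> * T"
    and T: "T = d x y * real i / real M" "x < n" "y < n" "i \<le> M * n"
    and ns: "\<And>j. j < K \<Longrightarrow> ns j \<le> n" "\<And>j. Suc j < K \<Longrightarrow> ns j \<le> ns (Suc j)"
      "length zs \<le> ns (K - 1)"
    and feasible: "route N \<sigma>" "\<And>j. j < K \<Longrightarrow> ns j \<le> card (visited_by N \<sigma> (T * q ^ j))"
  obtains zs' where "zs' \<in> set (labels (Suc r * round_length))" "length zs' = ns (K - 1)"
    "\<And>j i. \<lbrakk>length zs \<le> i; i < ns j; j < K\<rbrakk> \<Longrightarrow> arr zs' i \<le> 2 * (real \<beta> * T) + \<alpha> * (T * q ^ j)"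
    "cost p zs' \<le> cost p zs + (\<Sum>i=length zs..<ns (K - 1). \<bar>arr zs' i\<bar> powr p)"
proof -
  define g where "g j = (if j < K then ns j else if j = K then x else if j = K + 1 then y
    else if j = K + 2 then i else length zs)" for j
  have "1 \<le> M" using M_pos by simp
  then have base: "n < base" "M * n < base" using mult_le_mono1[of 1 M "n + 1"] by (simp_all add: base_def)
  have simple: "simple_route zs" using zs(1) by (rule labels_simple)
  have "g j < base" if "j < K + 4" for j
    using base ns(1)[of j] T(2-4) simple_route_length[OF simple] by (auto simp: g_def)
  then obtain m where m: "r * round_length \<le> m" "m < Suc r * round_length"
    "\<And>j. j < K + 4 \<Longrightarrow> digit m j = g j" using digit_in_round by blast
  let ?Ls = "labels m"
  have valid: "valid g" using ns T by (auto simp: valid_def g_def)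
  have scale: "scale g = T" by (simp add: scale_def g_def T(1))
  have nsg: "map g [0..<K] = map ns [0..<K]" by (simp add: g_def)
  have gb: "g (K - 1) = ns (K - 1)" using K_pos by (simp add: g_def)
  define zs0 where "zs0 = ?Ls ! parent g ?Ls"
  define zs' where "zs' = extend (ns (K - 1)) zs0 (answer g)"
  have "labels (Suc m) = new_labels g ?Ls" using new_labels_cong[of "digit m" g] m(3) by simp
  also have "\<dots> = ?Ls @ [zs']"
    unfolding new_labels_def zs'_def zs0_def gb using valid by (simp only: if_True)
  finally have "labels (Suc m) = ?Ls @ [zs']" .
  then have "zs' \<in> set (labels (Suc m))" by simp
  then have in_labels: "zs' \<in> set (labels (Suc r * round_length))"
    using labels_mono[of "Suc m" "Suc r * round_length"] m(2) by auto

  \<comment> \<open>The parent chosen by the program may differ from \<open>zs\<close>, but has the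
    same length, meets the same bound on its end and costs no more.\<close>
  have "zs \<in> set ?Ls" using labels_mono[OF m(1)] zs(1) by blast
  then obtain i0 where "i0 < length ?Ls" "?Ls ! i0 = zs" by (auto simp: in_set_conv_nth)
  then have "(length zs0 = length zs \<and> finish zs0 \<le> real \<beta> * T) \<and> cost p zs0 \<le> cost p zs"
    unfolding zs0_def parent_def
    using cheapest_min[of i0 "length ?Ls" "\<lambda>i. length (?Ls ! i) = g (K + 3) \<and> finish (?Ls ! i) \<le> real \<beta> * scale g"
        "\<lambda>i. cost p (?Ls ! i)"] zs(2) by (simp add: scale g_def)
  then have zs0: "length zs0 = length zs" "finish zs0 \<le> real \<beta> * T" "cost p zs0 \<le> cost p zs"
    by simp_all
  have "parent g ?Ls < length ?Ls"
    unfolding parent_def using labels_nonempty by (intro cheapest_less) simp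
  then have simple0: "simple_route zs0" unfolding zs0_def by (rule labels_simple[OF nth_mem])

  have "seg_solution 1 N (map ns [0..<K]) (deadlines T) \<sigma>"
    using feasible by (simp add: seg_solution_def deadlines_eq)
  then have "seg_solution \<alpha> N (map ns [0..<K]) (deadlines T) (answer g)"
    using seg metric seg_instance_guess[OF valid]
    unfolding seg_approx_algorithm_def seg_feasible_def answer_def scale nsg by blast
  then have answer: "route N (answer g)"
    "\<And>j. j < K \<Longrightarrow> ns j \<le> card (visited_by N (answer g) (\<alpha> * (T * q ^ j)))"
    by (simp_all add: seg_solution_def deadlines_eq)
  have mono: "ns j \<le> ns (K - 1)" if "j < K" for j
  proof -
    have "sorted (map ns [0..<K])" unfolding sorted_iff_nth_Suc using ns(2) by simp
    then show ?thesis using sorted_nth_mono[of "map ns [0..<K]" j "K - 1"] that by simp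
  qed
  have visit: "i < length zs'" "arr zs' i \<le> 2 * (real \<beta> * T) + \<alpha> * (T * q ^ j)"
    if "length zs \<le> i" "i < ns j" "j < K" for i j
  proof -
    have i: "length zs0 \<le> i" "i < ns (K - 1)" "i < card (visited_by N (answer g) (\<alpha> * (T * q ^ j)))"
      using that mono[of j] answer(2)[of j] zs0(1) by auto
    show "i < length zs'" unfolding zs'_def by (rule extend_visits(1)[OF simple0 answer(1) i])
    have "arr zs' i \<le> 2 * finish zs0 + \<alpha> * (T * q ^ j)"
      unfolding zs'_def by (rule extend_visits(2)[OF simple0 answer(1) i])
    with zs0(2) show "arr zs' i \<le> 2 * (real \<beta> * T) + \<alpha> * (T * q ^ j)" by simp
  qed
  have len: "length zs' = ns (K - 1)"
  proof (rule antisym)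
    show "length zs' \<le> ns (K - 1)" unfolding zs'_def using ns(3) zs0(1) by (intro length_extend_le) simp
    \<comment> \<open>If no vertex is to be added, \<open>visit\<close> says nothing but the parent
      is long enough; otherwise position \<open>ns (K - 1) - 1\<close> is new and reached.\<close>
    show "ns (K - 1) \<le> length zs'"
    proof (cases "ns (K - 1) = length zs")
      case True
      then show ?thesis unfolding zs'_def using length_extend_ge zs0(1) by metis
    next
      case False
      with ns(3) have "length zs \<le> ns (K - 1) - 1" "ns (K - 1) - 1 < ns (K - 1)" by linarith+
      with visit(1)[of "ns (K - 1) - 1" "K - 1"] K_pos show ?thesis by linarith
    qed
  qed
  have "cost p zs' = (\<Sum>i<length zs. \<bar>arr zs' i\<bar> powr p) + (\<Sum>i=length zs..<ns (K - 1). \<bar>arr zs' i\<bar> powr p)"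
    unfolding cost_def len lessThan_atLeast0 using ns(3) by (intro sum.atLeastLessThan_concat[symmetric]) simp_all
  also have "(\<Sum>i<length zs. \<bar>arr zs' i\<bar> powr p) = cost p zs0"
    unfolding cost_def zs0(1) zs'_def using zs0(1) by (intro sum.cong) (simp_all add: arrival_extend)
  finally show ?thesis using that[OF in_labels len visit(2)] zs0(3) by simp
qed

section \<open>Levels and chunks of the time axis\<close>

definition level :: "real \<Rightarrow> int" where
  "level t = \<lceil>log q t\<rceil> - 1"

lemma powi_less_iff: "q powi a < q powi b \<longleftrightarrow> a < b"
  using power_int_strict_increasing[of a b q] power_int_increasing[of b a q] q_gt_1
  by (cases "a < b") (auto simp: not_less)

lemma powi_pos: "0 < q powi a"
  using q_gt_1 by simp

text \<open>A ceiling minus 1 replaces the floor because the intervals are closed on the right: a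
  power of \<open>q\<close> belongs to the interval that it ends.\<close>

lemma level:
  assumes "0 < t"
  shows "q powi level t < t" "t \<le> q powi (level t + 1)"
proof -
  have powi: "q powi a = q powr real_of_int a" for a
    using q_gt_1 by (simp add: powr_real_of_int')
  have t: "q powr log q t = t" using q_gt_1 assms by (intro powr_log_cancel) simp_all
  have "real_of_int (level t) < log q t" "log q t \<le> real_of_int (level t + 1)"
    unfolding level_def by linarith+
  then have "q powr real_of_int (level t) < q powr log q t"
    "q powr log q t \<le> q powr real_of_int (level t + 1)"
    using q_gt_1 by (simp_all only: powr_less_cancel_iff powr_le_cancel_iff)
  then show "q powi level t < t" "t \<le> q powi (level t + 1)" unfolding powi t .
qed

text \<open>The level of \<open>t\<close> rounded down to the residue class of
  \<open>\<theta>\<close>, which is the cut exponent where the chunk of \<open>t\<close>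
  begins.\<close>

definition start :: "nat \<Rightarrow> real \<Rightarrow> int" where
  "start \<theta> t = level t - (level t - int \<theta>) mod int k"

lemma start:
  assumes "0 < t"
  shows "q powi start \<theta> t < t" "t \<le> q powi (start \<theta> t + int k)" "(start \<theta> t - int \<theta>) mod int k = 0"
proof -
  have r: "0 \<le> (level t - int \<theta>) mod int k" "(level t - int \<theta>) mod int k < int k"
    using k_pos by simp_all
  have "q powi start \<theta> t \<le> q powi level t"
    using r q_gt_1 by (intro power_int_increasing) (auto simp: start_def)
  also have "\<dots> < t" using assms by (rule level)
  finally show "q powi start \<theta> t < t" .
  have "t \<le> q powi (level t + 1)" using assms by (rule level)
  also have "\<dots> \<le> q powi (start \<theta> t + int k)"
    using r q_gt_1 by (intro power_int_increasing) (auto simp: start_def)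
  finally show "t \<le> q powi (start \<theta> t + int k)" .
  have "start \<theta> t - int \<theta> = (level t - int \<theta>) - (level t - int \<theta>) mod int k"
    by (simp add: start_def)
  then show "(start \<theta> t - int \<theta>) mod int k = 0" by (simp add: minus_mod_eq_mult_div)
qed

end

section \<open>Labels that compete with a given tour\<close>

locale tour = reduction p K A N h M \<beta> k \<alpha> for p K A N h M \<beta> k \<alpha> +
  fixes \<sigma> :: "nat list"
  assumes \<sigma>: "feasible_route N \<sigma>"
begin

abbreviation visit :: "nat \<Rightarrow> real" where
  "visit i \<equiv> arr \<sigma> i"

lemma route_\<sigma>: "route N \<sigma>" and distinct_\<sigma>: "distinct \<sigma>" and length_\<sigma>: "length \<sigma> = n"
  using \<sigma> by (auto simp: feasible_route_iff simple_route_def)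

lemma visit_mono: "j < n \<Longrightarrow> i \<le> j \<Longrightarrow> visit i \<le> visit j"
  using arrival_mono[OF route_\<sigma>] length_\<sigma> by simp

lemma visit_nonneg: "i < n \<Longrightarrow> 0 \<le> visit i"
  using arrival_nonneg[OF route_\<sigma>] length_\<sigma> by simp

definition visited :: "real \<Rightarrow> nat" where
  "visited \<tau> = card {i. i < n \<and> visit i \<le> \<tau>}"

lemma less_visited_iff: "i < visited \<tau> \<longleftrightarrow> i < n \<and> visit i \<le> \<tau>"
proof -
  have down: "{i. i < n \<and> visit i \<le> \<tau>} = {..<m} \<Longrightarrow> ?thesis" for m
    unfolding visited_def by auto
  let ?m = "LEAST m. m = n \<or> \<tau> < visit m"
  have m: "?m = n \<or> \<tau> < visit ?m" by (rule LeastI[of _ n]) simp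
  have "?m \<le> n" by (rule Least_le) simp
  have "{i. i < n \<and> visit i \<le> \<tau>} = {..<?m}"
  proof (intro set_eqI iffI)
    fix i assume "i \<in> {i. i < n \<and> visit i \<le> \<tau>}"
    then have i: "i < n" "visit i \<le> \<tau>" by simp_all
    have "\<not> ?m \<le> i" using m visit_mono[OF i(1)] i by force
    then show "i \<in> {..<?m}" by simp
  next
    fix i assume "i \<in> {..<?m}"
    then have "\<not> (i = n \<or> \<tau> < visit i)" "i < ?m" using not_less_Least by auto
    with \<open>?m \<le> n\<close> show "i \<in> {i. i < n \<and> visit i \<le> \<tau>}" by simp
  qed
  then show ?thesis by (rule down)
qed

lemma visited_le: "visited \<tau> \<le> n"
  using less_visited_iff[of n \<tau>] by (simp add: not_less[symmetric])

lemma visited_mono: "\<tau> \<le> \<tau>' \<Longrightarrow> visited \<tau> \<le> visited \<tau>'"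
  by (meson less_visited_iff not_less order_less_irrefl order_trans)

lemma card_visited_by: "card (visited_by N \<sigma> \<tau>) = visited \<tau>"
proof -
  have "visited_by N \<sigma> \<tau> = (!) \<sigma> ` {i. i < n \<and> visit i \<le> \<tau>}"
    unfolding visited_by_def length_\<sigma> by auto
  moreover have "inj_on ((!) \<sigma>) {i. i < n \<and> visit i \<le> \<tau>}"
    using distinct_\<sigma> length_\<sigma> by (auto simp: inj_on_def nth_eq_iff_index_eq)
  ultimately show ?thesis by (simp add: visited_def card_image)
qed

text \<open>The longest edge of a route approximates its length up to a factor \<open>n\<close>.\<close>

lemma visit_scale:
  assumes "i < n" "0 < visit i"
  obtains x y where "x < n" "y < n" "0 < d x y" "d x y \<le> visit i" "visit i \<le> real n * d x y"
proof -
  let ?e = "\<lambda>j. d (\<sigma> ! j) (\<sigma> ! Suc j)"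
  have "i \<noteq> 0" using assms(2) by (cases "i = 0") simp_all
  then have fin: "finite (?e ` {..<i})" "?e ` {..<i} \<noteq> {}" by auto
  obtain j where j: "j < i" "?e j = Max (?e ` {..<i})" using Max_in[OF fin] by auto
  then have max: "?e j' \<le> ?e j" if "j' < i" for j' using that Max_ge[OF fin(1)] by simp
  have less: "\<sigma> ! j' < n" if "j' \<le> i" for j'
    using that assms(1) length_\<sigma> by (intro route_nth_less[OF route_\<sigma>]) simp
  have nonneg: "0 \<le> ?e j'" if "j' < i" for j' using that less by (intro d_nonneg) simp_all
  have "visit i \<le> (\<Sum>j'<i. ?e j)" unfolding arrival_def using max by (intro sum_mono) simp
  also have "\<dots> = real i * ?e j" by simp
  also have "\<dots> \<le> real n * ?e j" using assms(1) nonneg[OF j(1)] by (intro mult_right_mono) simp_all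
  finally have upper: "visit i \<le> real n * ?e j" .
  have "?e j \<le> visit i" unfolding arrival_def using j(1) nonneg by (intro member_le_sum) auto
  moreover have "0 < ?e j" using upper assms(2) nonneg[OF j(1)] by (cases "?e j = 0") auto
  ultimately show ?thesis
    using j(1) upper by (intro that[OF less[of j] less[of "Suc j"]]) simp_all
qed

text \<open>The first summand is the return from a label that ends by \<open>\<beta>\<close> times
  the start of the chunk; the second is a deadline at most a factor \<open>q\<close> after the
  visit, stretched by \<open>\<alpha>\<close>. Visits at time 0 lie in no chunk.\<close>

definition bound :: "nat \<Rightarrow> nat \<Rightarrow> real" where
  "bound \<theta> i = (if visit i = 0 then 0
     else 2 * (real \<beta> * q powi start \<theta> (visit i)) + \<alpha> * (q * visit i))"

lemma bound_nonneg: "i < n \<Longrightarrow> 0 \<le> bound \<theta> i"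
  using powi_pos[of "start \<theta> (visit i)"] q_gt_1 \<alpha> visit_nonneg[of i] by (simp add: bound_def)

text \<open>Some distance \<open>d x y\<close> is within a factor \<open>n\<close> of the last
  visit, so \<open>q powi G\<close> is below \<open>n * d x y\<close>. Rounding it down to a
  multiple of \<open>d x y / M\<close> loses less than \<open>q powi G / (h + 1)\<close>, which is
  exactly the gap to \<open>q powi (G - 1)\<close>.\<close>

lemma chunk_scale:
  assumes a: "0 < a" "a - 1 < n" "0 < visit (a - 1)"
    and G: "q powi G < visit (a - 1)" "visit (a - 1) \<le> q powi (G + int k)"
  obtains x y i T where "x < n" "y < n" "i \<le> M * n" "T = d x y * real i / real M"
    "q powi (G - 1) < T" "T \<le> q powi G"
proof -
  obtain x y where xy: "x < n" "y < n" "0 < d x y" "d x y \<le> visit (a - 1)"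
    "visit (a - 1) \<le> real n * d x y"
    using visit_scale[OF a(2,3)] .
  define i where "i = nat \<lfloor>real M * q powi G / d x y\<rfloor>"
  define T where "T = d x y * real i / real M"
  have M': "0 < real M" using M_pos by simp
  have "0 \<le> real M * q powi G / d x y" using M' xy(3) powi_pos[of G] by simp
  then have i: "real i \<le> real M * q powi G / d x y" "real M * q powi G / d x y < real i + 1"
    unfolding i_def by linarith+
  have "real M * q powi G / d x y \<le> real M * (real n * d x y) / d x y"
    using G(1) xy M' by (intro divide_right_mono mult_left_mono) simp_all
  also have "\<dots> = real (M * n)" using xy(3) by simp
  finally have "i \<le> M * n" using i(1) by linarith
  moreover have "T \<le> q powi G"
    using i(1) xy(3) M' by (simp add: T_def field_simps)
  moreover have "q powi (G - 1) < T"
  proof -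
    have "real M * q powi G < d x y * real i + d x y"
      using i(2) xy(3) by (simp add: field_simps)
    then have "q powi G < (d x y * real i + d x y) / real M"
      using M' by (simp add: pos_less_divide_eq mult.commute)
    then have "q powi G - d x y / real M < T" by (simp add: T_def add_divide_distrib)
    \<comment> \<open>The distance may exceed \<open>q powi G\<close> by a factor up to
      \<open>q ^ k \<le> 2 ^ k\<close>, which is why \<open>M\<close> contains
      \<open>2 ^ k\<close>.\<close>
    moreover have "d x y / real M \<le> q powi G / real (h + 1)"
    proof -
      have "d x y \<le> q powi (G + int k)" using xy(4) G(2) by simp
      also have "\<dots> = q powi G * q ^ k" using q_gt_1 by (simp add: power_int_add)
      also have "\<dots> \<le> q powi G * 2 ^ k"
        using q_gt_1 q_le_2 powi_pos[of G] by (intro mult_left_mono power_mono) simp_all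
      finally have "d x y / real M \<le> q powi G * 2 ^ k / real M" using M' by (simp add: divide_right_mono)
      also have "\<dots> = q powi G / real (h + 1)"
      proof -
        have "real M = real (h + 1) * 2 ^ k" by (simp only: M of_nat_mult of_nat_power of_nat_numeral)
        then show ?thesis by (simp del: of_nat_add of_nat_Suc)
      qed
      finally show ?thesis .
    qed
    moreover have "q powi (G - 1) = q powi G - q powi G / real (h + 1)"
    proof -
      have "q powi (G - 1) = q powi G / q" using q_gt_1 by (simp add: power_int_diff)
      also have "\<dots> = q powi G * (1 / q)" by simp
      also have "1 / q = 1 - 1 / real (h + 1)" using h_pos by (simp add: q_def field_simps)
      finally show ?thesis by (simp add: algebra_simps)
    qed
    ultimately show ?thesis by linarith
  qed
  ultimately show ?thesis using that xy(1,2) T_def by blast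
qed

text \<open>Strong induction on the number of vertices instead of the chunks: empty chunks are
  skipped, and each other one adds a vertex, so \<open>a\<close> rounds suffice. The end is bounded
  with \<open>G - 1\<close> because the scale guessed for a chunk starting at
  \<open>q powi G\<close> is only known to exceed \<open>q powi (G - 1)\<close>, and the label must
  pass the test against it.\<close>

lemma labels_of_tour:
  assumes "(G - int \<theta>) mod int k = 0" "visited (q powi G) = a"
  shows "\<exists>zs\<in>set (labels (a * round_length)). length zs = a \<and>
    cost p zs \<le> (\<Sum>i<a. bound \<theta> i powr p) \<and> finish zs \<le> real \<beta> * q powi (G - 1)"
  using assms
proof (induction a arbitrary: G rule: less_induct)
  case (less a)
  have iff: "i < a \<longleftrightarrow> i < n \<and> visit i \<le> q powi G" for i
    using less_visited_iff[of i "q powi G"] less.prems(2) by simp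
  have "0 < a" unfolding iff using source_less powi_pos[of G] by simp
  then have a: "a - 1 < n" "visit (a - 1) \<le> q powi G" and Suc: "Suc (a - 1) = a"
    using iff[of "a - 1"] by simp_all
  have below: "visit i \<le> visit (a - 1)" if "i < a" for i using that a(1) by (intro visit_mono) simp_all
  show ?case
  proof (cases "visit (a - 1) = 0")
    case True
    \<comment> \<open>Now all \<open>a\<close> visits are at time 0, below every power of
      \<open>q\<close>. The scale 0, guessed as \<open>x = y\<close> with multiplier 0, handles them
      as a chunk with zero deadlines.\<close>
    have v0: "visited 0 = a"
    proof (rule antisym)
      show "visited 0 \<le> a" using visited_mono[of 0 "q powi G"] powi_pos[of G] less.prems(2) by simp
      show "a \<le> visited 0"
        using less_visited_iff[of "a - 1" 0] True a(1) \<open>0 < a\<close> by simp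
    qed
    have init: "[source N] \<in> set (labels ((a - 1) * round_length))"
      using labels_mono[of 0 "(a - 1) * round_length"] by simp
    have s: "source N < n" by (rule source_less)
    obtain zs where zs: "zs \<in> set (labels (Suc (a - 1) * round_length))" "length zs = a"
      "\<And>j i. \<lbrakk>length [source N] \<le> i; i < a; j < K\<rbrakk> \<Longrightarrow>
        arr zs i \<le> 2 * (real \<beta> * 0) + \<alpha> * (0 * q ^ j)"
      "cost p zs \<le> cost p [source N] + (\<Sum>i=length [source N]..<a. \<bar>arr zs i\<bar> powr p)"
      by (rule extend_by_chunk[of "[source N]" "a - 1" 0 "source N" "source N" 0 "\<lambda>_. a" \<sigma>])
        (use init s route_\<sigma> card_visited_by v0 visited_le[of 0] \<open>0 < a\<close> in
          \<open>simp_all add: finish_def Suc_le_eq\<close>)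
    have "route N zs" using labels_simple[OF zs(1)] by (simp add: simple_route_def)
    then have zero: "arr zs i = 0" if "i < a" for i
      using zs(3)[of i 0] that arrival_nonneg[of zs i] zs(2) K_pos by (cases "i = 0") auto
    have "cost p zs = 0" unfolding cost_def using zero zs(2) by simp
    moreover have "finish zs = 0" unfolding finish_def using zero zs(2) \<open>0 < a\<close> by simp
    moreover have "0 \<le> real \<beta> * q powi (G - 1)" using powi_pos[of "G - 1"] by simp
    ultimately show ?thesis using zs(1,2) unfolding Suc by (auto intro!: bexI[of _ zs] sum_nonneg)
  next
    case False
    then have pos: "0 < visit (a - 1)" using visit_nonneg[OF a(1)] by simp
    \<comment> \<open>The beginning of the chunk of the last visit; going back directly to it skips
      the empty chunks before \<open>G\<close>.\<close>
    define G' where "G' = start \<theta> (visit (a - 1))"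
    have G': "q powi G' < visit (a - 1)" "visit (a - 1) \<le> q powi (G' + int k)"
      "(G' - int \<theta>) mod int k = 0"
      unfolding G'_def using start[OF pos] by simp_all
    have k: "0 < int k" using k_pos by simp
    have "q powi G' < q powi G" using G'(1) a(2) by simp
    then have "G' < G" by (simp add: powi_less_iff)
    then have "G' + int k \<le> G"
      by (intro cong_gap[OF less.prems(1) _ _ k]) (use G'(3) in \<open>simp_all add: diff_add_eq[symmetric]\<close>)
    define a' where "a' = visited (q powi G')"
    have iff': "i < a' \<longleftrightarrow> i < n \<and> visit i \<le> q powi G'" for i
      unfolding a'_def by (rule less_visited_iff)
    have "\<not> a - 1 < a'" unfolding iff' using G'(1) by simp
    then have a': "a' \<le> a - 1" "a' < a" using \<open>0 < a\<close> by simp_all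
    obtain zs where zs: "zs \<in> set (labels (a' * round_length))" "length zs = a'"
      "cost p zs \<le> (\<Sum>i<a'. bound \<theta> i powr p)" "finish zs \<le> real \<beta> * q powi (G' - 1)"
      using less.IH[OF a'(2) G'(3)] a'_def by blast
    obtain x y i T where T: "x < n" "y < n" "i \<le> M * n" "T = d x y * real i / real M"
      "q powi (G' - 1) < T" "T \<le> q powi G'"
      using chunk_scale[OF \<open>0 < a\<close> a(1) pos G'(1,2)] .
    define E where "E = q powi (G' + int k)"
    \<comment> \<open>The last deadlines may exceed the end \<open>E\<close> of the chunk; asking only for the visits
      before \<open>E\<close> makes the next chunk start with the right number of vertices.\<close>
    define ns where "ns j = visited (min (T * q ^ j) E)" for j
    have T_pos: "0 < T" using T(5) powi_pos[of "G' - 1"] by linarith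
    have "E \<le> q powi G" unfolding E_def using \<open>G' + int k \<le> G\<close> q_gt_1 by (intro power_int_increasing) simp_all
    \<comment> \<open>Since \<open>K - 1 = k + 1\<close>, the last deadline reaches \<open>E\<close>
      although only \<open>q powi (G' - 1) < T\<close> is known.\<close>
    have E_le: "E \<le> T * q ^ (K - 1)"
    proof -
      have "E = q powi (G' - 1) * q ^ (K - 1)"
        unfolding E_def using q_gt_1 K by (simp flip: power_int_of_nat power_int_add)
      also have "\<dots> \<le> T * q ^ (K - 1)" using T(5) q_gt_1 by (intro mult_right_mono) simp_all
      finally show ?thesis .
    qed
    have ns_last: "ns (K - 1) = a"
    proof (rule antisym)
      have "ns (K - 1) = visited E" using E_le by (simp add: ns_def min_absorb2)
      then show "ns (K - 1) \<le> a" using visited_mono[OF \<open>E \<le> q powi G\<close>] less.prems(2) by simp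
      show "a \<le> ns (K - 1)"
        unfolding \<open>ns (K - 1) = visited E\<close>
        using less_visited_iff[of "a - 1" E] a(1) G'(2) \<open>0 < a\<close> by (simp add: E_def)
    qed
    have in_labels: "zs \<in> set (labels ((a - 1) * round_length))"
      using labels_mono[of "a' * round_length" "(a - 1) * round_length"] a'(1) zs(1) by auto
    have finish: "finish zs \<le> real \<beta> * T"
      using zs(4) T(5) mult_left_mono[of "q powi (G' - 1)" T "real \<beta>"] by simp
    have ns_mono: "ns j \<le> ns (Suc j)" for j
      unfolding ns_def using T_pos q_gt_1
      by (intro visited_mono min.mono mult_left_mono power_increasing) simp_all
    have ns_feasible: "ns j \<le> card (visited_by N \<sigma> (T * q ^ j))" for j
      unfolding ns_def card_visited_by by (intro visited_mono) simp
    have ns_le: "ns j \<le> n" for j unfolding ns_def by (rule visited_le)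
    have len: "length zs \<le> ns (K - 1)" using zs(2) a'(2) ns_last by simp
    obtain zs' where zs': "zs' \<in> set (labels (Suc (a - 1) * round_length))" "length zs' = a"
      and arr_zs': "\<And>j i. \<lbrakk>a' \<le> i; i < ns j; j < K\<rbrakk> \<Longrightarrow>
        arr zs' i \<le> 2 * (real \<beta> * T) + \<alpha> * (T * q ^ j)"
      and cost_zs': "cost p zs' \<le> cost p zs + (\<Sum>i=a'..<a. \<bar>arr zs' i\<bar> powr p)"
      using extend_by_chunk[OF in_labels finish T(4,1,2,3) ns_le ns_mono len route_\<sigma> ns_feasible]
      unfolding ns_last zs(2) by blast
    have "route N zs'" using labels_simple[OF zs'(1)] by (simp add: simple_route_def)
    then have nonneg: "0 \<le> arr zs' i" if "i < a" for i using that zs'(2) by (intro arrival_nonneg) simp_all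
    have first: "2 * (real \<beta> * T) \<le> 2 * (real \<beta> * q powi G')"
      using T(6) by (simp add: mult_left_mono)
    have deadline: "arr zs' i \<le> 2 * (real \<beta> * q powi G') + \<alpha> * (q * visit i)" if i: "a' \<le> i" "i < a" for i
    proof -
      have "i < n" using i(2) a(1) by simp
      have G'_less: "q powi G' < visit i" using iff'[of i] i(1) \<open>i < n\<close> by simp
      have le_E: "visit i \<le> E" using below[OF i(2)] G'(2) by (simp add: E_def)
      \<comment> \<open>The first deadline that is not before the visit. Its predecessor is earlier
        than the visit, so it is late by less than a factor \<open>q\<close>; if it has no
        predecessor, \<open>T \<le> q powi G'\<close> is already below the visit time.\<close>
      let ?j = "LEAST j. visit i \<le> T * q ^ j"
      have ex: "visit i \<le> T * q ^ (K - 1)" using le_E E_le by simp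
      have j: "visit i \<le> T * q ^ ?j" by (rule LeastI[of "\<lambda>j. visit i \<le> T * q ^ j", OF ex])
      have "?j \<le> K - 1" by (rule Least_le[of "\<lambda>j. visit i \<le> T * q ^ j", OF ex])
      then have "?j < K" using K_pos by simp
      have "T * q ^ ?j \<le> q * visit i"
      proof (cases ?j)
        case 0
        have "T * q ^ ?j \<le> visit i" unfolding 0 using T(6) G'_less by simp
        also have "\<dots> \<le> q * visit i"
          using mult_right_mono[of 1 q "visit i"] q_gt_1 visit_nonneg[OF \<open>i < n\<close>] by simp
        finally show ?thesis .
      next
        case (Suc j')
        then have "\<not> visit i \<le> T * q ^ j'" using not_less_Least[of j' "\<lambda>j. visit i \<le> T * q ^ j"] by simp
        then have "q * (T * q ^ j') \<le> q * visit i" using q_gt_1 by simp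
        then show ?thesis unfolding Suc by (simp add: ac_simps)
      qed
      then have "\<alpha> * (T * q ^ ?j) \<le> \<alpha> * (q * visit i)" using \<alpha> by (intro mult_left_mono) simp_all
      moreover have "i < ns ?j" unfolding ns_def less_visited_iff using \<open>i < n\<close> j le_E by simp
      then have "arr zs' i \<le> 2 * (real \<beta> * T) + \<alpha> * (T * q ^ ?j)"
        using arr_zs' i(1) \<open>?j < K\<close> by blast
      ultimately show ?thesis using first by linarith
    qed
    \<comment> \<open>\<open>bound\<close> refers to the chunk of visit \<open>i\<close> itself,
      which begins at \<open>G'\<close> or later because the visit comes after that cut.\<close>
    have "arr zs' i \<le> bound \<theta> i" if i: "a' \<le> i" "i < a" for i
    proof -
      have "i < n" using i(2) a(1) by simp
      have G'_less: "q powi G' < visit i" using iff'[of i] i(1) \<open>i < n\<close> by simp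
      then have vis: "0 < visit i" using powi_pos[of G'] by linarith
      have "q powi G' < q powi (start \<theta> (visit i) + int k)"
        using G'_less start(2)[OF vis, of \<theta>] by linarith
      then have "G' < start \<theta> (visit i) + int k" by (simp add: powi_less_iff)
      then have "G' \<le> start \<theta> (visit i)"
        by (intro cong_gap[OF start(3)[OF vis] G'(3) _ k]) simp
      then have "q powi G' \<le> q powi start \<theta> (visit i)" using q_gt_1 by (intro power_int_increasing) simp_all
      then have "real \<beta> * q powi G' \<le> real \<beta> * q powi start \<theta> (visit i)" by (intro mult_left_mono) simp_all
      then show ?thesis using deadline[OF i] vis by (simp add: bound_def)
    qed
    then have "(\<Sum>i=a'..<a. \<bar>arr zs' i\<bar> powr p) \<le> (\<Sum>i=a'..<a. bound \<theta> i powr p)"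
      using p nonneg by (intro sum_mono powr_mono2) auto
    moreover have "(\<Sum>i<a'. bound \<theta> i powr p) + (\<Sum>i=a'..<a. bound \<theta> i powr p) = (\<Sum>i<a. bound \<theta> i powr p)"
      unfolding lessThan_atLeast0 using a' by (intro sum.atLeastLessThan_concat) simp_all
    ultimately have "cost p zs' \<le> (\<Sum>i<a. bound \<theta> i powr p)" using cost_zs' zs(3) by linarith
    \<comment> \<open>The origin of 8: the return takes at most \<open>\<beta> * S / 2\<close>, and
      the last deadline leads to at most \<open>4 * \<alpha> * S\<close>, which is again at most
      \<open>\<beta> * S / 2\<close>.\<close>
    moreover have "finish zs' \<le> real \<beta> * q powi (G - 1)"
    proof -
      define S where "S = q powi (G' + int k - 1)"
      have S_pos: "0 < S" unfolding S_def by (rule powi_pos)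
      have "finish zs' \<le> 2 * (real \<beta> * q powi G') + \<alpha> * (q * visit (a - 1))"
        unfolding finish_def zs'(2) using a' by (intro deadline) simp_all
      moreover have "q powi G' * 4 \<le> S"
      proof -
        have "G' + int k - 1 = G' + int (k - 1)" using k_pos by simp
        then have "S = q powi (G' + int (k - 1))" unfolding S_def by (rule arg_cong)
        then have "S = q powi G' * q ^ (k - 1)" using q_gt_1 by (simp add: power_int_add)
        then show ?thesis using four_le_q_power powi_pos[of G'] by (simp add: mult_left_mono)
      qed
      then have "real \<beta> * (q powi G' * 4) \<le> real \<beta> * S" by (intro mult_left_mono) simp_all
      moreover have "q * visit (a - 1) \<le> 4 * S"
      proof -
        have "q * visit (a - 1) \<le> q * E" using G'(2) q_gt_1 by (simp add: E_def)
        also have "E = q * S"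
          unfolding E_def S_def using q_gt_1 by (simp add: power_int_diff)
        also have "q * (q * S) = (q * q) * S" by simp
        also have "\<dots> \<le> (2 * 2) * S"
          using q_le_2 q_gt_1 S_pos by (intro mult_right_mono mult_mono) simp_all
        finally show ?thesis by simp
      qed
      then have "\<alpha> * (q * visit (a - 1)) \<le> \<alpha> * (4 * S)" using \<alpha> by (intro mult_left_mono) simp_all
      moreover have "8 * \<alpha> * S \<le> real \<beta> * S" using \<beta>(1) S_pos by (intro mult_right_mono) simp_all
      moreover have "S \<le> q powi (G - 1)"
        unfolding S_def using \<open>G' + int k \<le> G\<close> q_gt_1 by (intro power_int_increasing) simp_all
      then have "real \<beta> * S \<le> real \<beta> * q powi (G - 1)" by (intro mult_left_mono) simp_all
      ultimately show ?thesis by linarith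
    qed
    ultimately show ?thesis using zs' unfolding Suc by blast
  qed
qed

end

section \<open>Averaging over the offsets\<close>

text \<open>Convexity of the power function between 1 and 19. The 18 stems from the return trip, as
  \<open>2 * \<beta> \<le> 18 * \<alpha>\<close>.\<close>

lemma one_plus_powr_le:
  fixes p y :: real
  assumes "1 \<le> p" "0 \<le> y" "y \<le> 1"
  shows "(1 + 18 * y) powr p \<le> 1 + 19 powr p * y"
proof -
  have "((1 - y) *\<^sub>R 1 + y *\<^sub>R 19) powr p \<le> (1 - y) * 1 powr p + y * 19 powr p"
    using convex_onD[OF powr_convex[OF assms(1)], of y 1 19] assms by simp
  also have "\<dots> \<le> 1 + 19 powr p * y" using assms by simp
  also have "(1 - y) *\<^sub>R 1 + y *\<^sub>R 19 = 1 + 18 * y" by simp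
  finally show ?thesis .
qed

text \<open>As the offset varies, a fixed level has each distance to the preceding cut exactly once,
  which turns the sum of penalties into a geometric series.\<close>

lemma bij_betw_minus_mod:
  assumes "0 < k"
  shows "bij_betw (\<lambda>j. nat ((L - int j) mod int k)) {..<k} {..<k}"
proof -
  have "inj_on (\<lambda>j. nat ((L - int j) mod int k)) {..<k}"
  proof (rule inj_onI)
    fix i j assume *: "i \<in> {..<k}" "j \<in> {..<k}"
      and "nat ((L - int i) mod int k) = nat ((L - int j) mod int k)"
    moreover have "0 \<le> (L - int i') mod int k" for i' using assms by simp
    ultimately have "(L - int i) mod int k = (L - int j) mod int k"
      by (simp only: eq_nat_nat_iff)
    then have "int k dvd (L - int i) - (L - int j)" by (simp only: mod_eq_dvd_iff)
    then have "int k dvd int j - int i" by simp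
    then have "int j mod int k = int i mod int k" by (simp only: mod_eq_dvd_iff)
    then show "i = j" using * by simp
  qed
  moreover have "(\<lambda>j. nat ((L - int j) mod int k)) ` {..<k} \<subseteq> {..<k}"
    using assms by (auto simp: nat_less_iff)
  ultimately show ?thesis by (simp add: bij_betw_def endo_inj_surj)
qed

context tour
begin

text \<open>The penalty for the return to the source decays geometrically along a chunk.\<close>

definition penalty :: "nat \<Rightarrow> real \<Rightarrow> real" where
  "penalty \<theta> t = (1 / q) ^ nat ((level t - int \<theta>) mod int k)"

lemma penalty_nonneg: "0 \<le> penalty \<theta> t" and penalty_le_1: "penalty \<theta> t \<le> 1"
  unfolding penalty_def using q_gt_1 by (auto intro!: power_le_one)

lemma powi_start_le:
  assumes "0 < t"
  shows "q powi start \<theta> t \<le> t * penalty \<theta> t"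
proof -
  define r where "r = nat ((level t - int \<theta>) mod int k)"
  have "start \<theta> t = level t - int r" using k_pos by (simp add: r_def start_def)
  then have "q powi start \<theta> t = q powi level t * (1 / q) ^ r"
    using q_gt_1 by (simp add: power_int_diff power_one_over)
  also have "\<dots> \<le> t * (1 / q) ^ r" using level(1)[OF assms] q_gt_1 by (intro mult_right_mono) simp_all
  finally show ?thesis unfolding penalty_def r_def .
qed

text \<open>The infinite geometric series with ratio \<open>1 / q\<close> has the value
  \<open>h + 1\<close>, independently of \<open>k\<close>.\<close>

lemma sum_penalty: "(\<Sum>\<theta><k. penalty \<theta> t) \<le> real (h + 1)"
proof -
  have "(\<Sum>\<theta><k. penalty \<theta> t) = (\<Sum>r<k. (1 / q) ^ r)"
    unfolding penalty_def by (rule sum.reindex_bij_betw[OF bij_betw_minus_mod[OF k_pos]])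
  also have "\<dots> = (1 - (1 / q) ^ k) / (1 - 1 / q)"
    using q_gt_1 by (simp add: sum_gp_strict)
  also have "\<dots> \<le> 1 / (1 - 1 / q)"
    using q_gt_1 by (intro divide_right_mono) simp_all
  also have "1 - 1 / q = 1 / real (h + 1)" using h_pos by (simp add: q_def field_simps)
  finally show ?thesis by simp
qed

text \<open>Two factors \<open>q\<close> are lost, one by the spacing of the deadlines and one by
  the average delay, and \<open>q * q \<le> 1 + 3 / h\<close>.\<close>

lemma sum_bound:
  assumes "i < n"
  shows "(\<Sum>\<theta><k. bound \<theta> i powr p) \<le> real k * ((1 + 3 / real h) * \<alpha> * visit i) powr p"
proof (cases "visit i = 0")
  case False
  define t where "t = visit i"
  have t: "0 < t" using False visit_nonneg[OF assms] by (simp add: t_def)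
  define B where "B = (\<alpha> * t * q) powr p"
  have B: "0 \<le> B" by (simp add: B_def)
  have h: "1 \<le> real h" using h_pos by simp
  have each: "bound \<theta> i powr p \<le> B * (1 + 19 powr p * penalty \<theta> t)" for \<theta>
  proof -
    have "real \<beta> * q powi start \<theta> t \<le> (9 * \<alpha>) * (t * penalty \<theta> t)"
      using \<beta>(2) \<alpha> powi_start_le[OF t, of \<theta>] powi_pos[of "start \<theta> t"] by (intro mult_mono) simp_all
    \<comment> \<open>Enlarging the delay by \<open>q\<close> allows \<open>\<alpha> * t * q\<close>
      to be factored out.\<close>
    moreover have "(\<alpha> * t * penalty \<theta> t) * 1 \<le> (\<alpha> * t * penalty \<theta> t) * q"
      using \<alpha> t q_gt_1 penalty_nonneg[of \<theta> t] by (intro mult_left_mono) simp_all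
    ultimately have "bound \<theta> i \<le> \<alpha> * t * q * (1 + 18 * penalty \<theta> t)"
      using False by (simp add: bound_def t_def[symmetric] algebra_simps)
    then have "bound \<theta> i powr p \<le> (\<alpha> * t * q * (1 + 18 * penalty \<theta> t)) powr p"
      using bound_nonneg[OF assms] p by (intro powr_mono2) simp_all
    also have "\<dots> = B * (1 + 18 * penalty \<theta> t) powr p"
      unfolding B_def using \<alpha> t q_gt_1 penalty_nonneg[of \<theta> t] by (intro powr_mult) 
    also have "\<dots> \<le> B * (1 + 19 powr p * penalty \<theta> t)"
      using B p by (intro mult_left_mono one_plus_powr_le penalty_nonneg penalty_le_1)
    finally show ?thesis .
  qed
  have "(\<Sum>\<theta><k. bound \<theta> i powr p) \<le> (\<Sum>\<theta><k. B * (1 + 19 powr p * penalty \<theta> t))"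
    by (intro sum_mono each)
  also have "\<dots> = B * (real k + 19 powr p * (\<Sum>\<theta><k. penalty \<theta> t))"
    by (simp add: sum_distrib_left[symmetric] sum.distrib)
  also have "\<dots> \<le> B * (real k * q)"
  proof (rule mult_left_mono[OF _ B])
    \<comment> \<open>The reason for the size of \<open>k\<close>: the weighted penalties add up to
      at most \<open>k / h\<close>.\<close>
    have "19 powr p * (\<Sum>\<theta><k. penalty \<theta> t) \<le> 19 powr p * (2 * real h)"
      using sum_penalty[of t] h by (intro mult_left_mono) simp_all
    also have "\<dots> = 2 * 19 powr p * (real h)\<^sup>2 / real h"
      using h by (simp add: power2_eq_square)
    also have "\<dots> \<le> real k / real h" using k h by (intro divide_right_mono) simp_all
    finally show "real k + 19 powr p * (\<Sum>\<theta><k. penalty \<theta> t) \<le> real k * q"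
      by (simp add: q_eq algebra_simps)
  qed
  \<comment> \<open>Taking the second \<open>q\<close> under the power makes it a factor of the
    visit time.\<close>
  also have "\<dots> \<le> B * (real k * q powr p)"
    using powr_mono[of 1 p q] p q_gt_1 B by (intro mult_left_mono) simp_all
  also have "\<dots> = real k * (\<alpha> * t * q * q) powr p"
    unfolding B_def using powr_mult[of "\<alpha> * t * q" q p] by simp
  also have "\<dots> \<le> real k * ((1 + 3 / real h) * \<alpha> * t) powr p"
  proof -
    have "1 / real h * (1 / real h) \<le> 1 * (1 / real h)" using h by (intro mult_right_mono) simp_all
    then have "q * q \<le> 1 + 3 / real h" by (simp add: q_eq algebra_simps)
    then have "\<alpha> * t * (q * q) \<le> \<alpha> * t * (1 + 3 / real h)" using \<alpha> t by (intro mult_left_mono) simp_all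
    then have "\<alpha> * t * q * q \<le> (1 + 3 / real h) * \<alpha> * t" by (simp add: ac_simps)
    then show ?thesis using \<alpha> t q_gt_1 p by (intro mult_left_mono powr_mono2) simp_all
  qed
  finally show ?thesis unfolding t_def .
qed (simp add: bound_def)

text \<open>Some offset is no worse than the average. A single offset has to serve the whole tour,
  hence the exchange of the sums.\<close>

lemma good_offset:
  "\<exists>\<theta><k. (\<Sum>i<n. bound \<theta> i powr p) \<le> (\<Sum>i<n. ((1 + 3 / real h) * \<alpha> * visit i) powr p)"
proof (rule ccontr)
  let ?X = "\<Sum>i<n. ((1 + 3 / real h) * \<alpha> * visit i) powr p"
  assume "\<not> (\<exists>\<theta><k. (\<Sum>i<n. bound \<theta> i powr p) \<le> ?X)"
  then have "(\<Sum>\<theta><k. ?X) < (\<Sum>\<theta><k. \<Sum>i<n. bound \<theta> i powr p)"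
    using k_pos by (intro sum_strict_mono[of "{..<k}"]) (auto simp: not_le simp del: sum_constant)
  also have "\<dots> = (\<Sum>i<n. \<Sum>\<theta><k. bound \<theta> i powr p)" by (rule sum.swap)
  also have "\<dots> \<le> (\<Sum>i<n. real k * ((1 + 3 / real h) * \<alpha> * visit i) powr p)"
    by (intro sum_mono sum_bound) simp
  also have "\<dots> = (\<Sum>\<theta><k. ?X)" by (simp add: sum_distrib_left)
  finally show False by simp
qed

lemma good_label:
  "\<exists>zs\<in>set (labels iteration_count). length zs = n \<and>
     cost p zs \<le> ((1 + 3 / real h) * \<alpha>) powr p * cost p \<sigma>"
proof -
  obtain \<theta> where \<theta>: "\<theta> < k"
    "(\<Sum>i<n. bound \<theta> i powr p) \<le> (\<Sum>i<n. ((1 + 3 / real h) * \<alpha> * visit i) powr p)"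
    using good_offset by blast
  have n: "0 < n" using source_less by simp
  \<comment> \<open>A cut not before the last visit, so that all \<open>n\<close> vertices count as
    visited; if all visits are at time 0, any cut will do.\<close>
  obtain G where G: "visit (n - 1) \<le> q powi G" "(G - int \<theta>) mod int k = 0"
  proof (cases "visit (n - 1) = 0")
    case True
    then show ?thesis using that[of "int \<theta>"] powi_pos[of "int \<theta>"] by simp
  next
    case False
    then have pos: "0 < visit (n - 1)" using visit_nonneg[of "n - 1"] n by simp
    have "start \<theta> (visit (n - 1)) + int k - int \<theta> = (start \<theta> (visit (n - 1)) - int \<theta>) + int k" by simp
    then have "(start \<theta> (visit (n - 1)) + int k - int \<theta>) mod int k = 0"
      using start(3)[OF pos, of \<theta>] by (simp only: mod_add_self2)
    then show ?thesis by (rule that[OF start(2)[OF pos]])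
  qed
  have "visited (q powi G) = n"
    using visited_le[of "q powi G"] less_visited_iff[of "n - 1" "q powi G"] G(1) n by simp
  from labels_of_tour[OF G(2) this] obtain zs where zs: "zs \<in> set (labels (n * round_length))"
    "length zs = n" "cost p zs \<le> (\<Sum>i<n. bound \<theta> i powr p)" by blast
  have "cost p zs \<le> (\<Sum>i<n. ((1 + 3 / real h) * \<alpha> * visit i) powr p)" using zs(3) \<theta>(2) by linarith
  also have "\<dots> = (\<Sum>i<n. ((1 + 3 / real h) * \<alpha>) powr p * \<bar>visit i\<bar> powr p)"
    using visit_nonneg \<alpha> by (intro sum.cong) (simp_all add: powr_mult)
  also have "\<dots> = ((1 + 3 / real h) * \<alpha>) powr p * cost p \<sigma>"
    by (simp add: cost_def length_\<sigma> sum_distrib_left)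
  finally show ?thesis using zs(1,2) by (auto simp: iteration_count_def round_length_def)
qed

end

section \<open>Approximation ratio and polynomial bounds\<close>

lemma (in reduction) wp_lp_program_approx:
  "wp (lp_program K h M \<beta>) (\<lambda>t m rs. feasible_route N (result N t) \<and>
    lp_objective p N (result N t) \<le> (1 + 3 / real h) * \<alpha> * lp_opt p N \<and> length rs \<le> iteration_count \<and>
    m \<le> (iteration_count + 1) * (4 * iteration_count + 3 * n + 5 * K + 41) + 15 + (4 * n + 12) * answered rs)
    (initial_state N)"
proof -
  obtain \<sigma> where opt: "feasible_route N \<sigma>" "lp_objective p N \<sigma> = lp_opt p N"
    by (rule lp_opt_attained)
  interpret tour p K A N h M \<beta> k \<alpha> \<sigma> by unfold_locales (rule opt(1))
  obtain zs where zs: "zs \<in> set (labels iteration_count)" "length zs = n"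
    "cost p zs \<le> ((1 + 3 / real h) * \<alpha>) powr p * cost p \<sigma>" using good_label by blast
  have approx: "lp_objective p N xs \<le> (1 + 3 / real h) * \<alpha> * lp_opt p N"
    if "feasible_route N xs" "cost p xs \<le> cost p zs" for xs
  proof -
    let ?\<rho> = "(1 + 3 / real h) * \<alpha>"
    have "0 \<le> ?\<rho>" using \<alpha> by simp
    have "lp_objective p N xs = cost p xs powr (1 / p)" using that(1) by (rule lp_objective_eq)
    also have "\<dots> \<le> (?\<rho> powr p * cost p \<sigma>) powr (1 / p)"
      using that(2) zs(3) p cost_nonneg[of p xs] by (intro powr_mono2) simp_all
    also have "\<dots> = ?\<rho> * cost p \<sigma> powr (1 / p)"
      using \<open>0 \<le> ?\<rho>\<close> \<alpha> p cost_nonneg[of p \<sigma>] by (simp add: powr_mult powr_powr)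
    also have "\<dots> = ?\<rho> * lp_opt p N" using lp_objective_eq[OF opt(1), of p] opt(2) by simp
    finally show ?thesis .
  qed
  show ?thesis by (rule wp_mono[OF wp_lp_program[OF zs(1,2)]]) (use approx in blast)
qed

text \<open>With two vertices at distance 1 and deadline 1, a factor below 1 leaves no time to reach
  the second vertex. The choice of \<open>\<beta>\<close> relies on this.\<close>

lemma seg_approx_algorithm_ge_1:
  assumes "seg_approx_algorithm \<alpha> K A" "0 < K"
  shows "1 \<le> \<alpha>"
proof (rule ccontr)
  assume "\<not> 1 \<le> \<alpha>"
  define N :: network where
    "N = \<lparr>nverts = 2, source = 0, travel = (\<lambda>x y. if x = y then 0 else 1)\<rparr>"
  have metric: "metric_network N" by (auto simp: metric_network_def verts_def N_def)
  interpret metric N by unfold_locales (rule metric)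
  let ?ns = "map (\<lambda>_. 2 :: nat) [0..<K]" and ?ts = "map (\<lambda>_. 1 :: real) [0..<K]"
  have inst: "seg_instance N K ?ns ?ts"
    by (auto simp: seg_instance_def N_def sorted_iff_nth_mono)
  have "visited_by N [0, 1] 1 = {0, 1}"
  proof -
    have "visited_by N [0, 1] 1 = (!) [0, 1] ` {i. i < 2 \<and> arrival N [0, 1] i \<le> 1}"
      by (auto simp: visited_by_def)
    also have "{i. i < 2 \<and> arrival N [0, 1] i \<le> 1} = {0, 1}"
      by (auto simp: less_2_cases_iff arrival_def N_def)
    finally show ?thesis by simp
  qed
  then have "seg_solution 1 N ?ns ?ts [0, 1]"
    by (simp add: seg_solution_def route_def verts_def N_def)
  then have "seg_solution \<alpha> N ?ns ?ts (A N ?ns ?ts)"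
    using assms(1) metric inst unfolding seg_approx_algorithm_def seg_feasible_def by blast
  then obtain xs where xs: "route N xs" "2 \<le> card (visited_by N xs \<alpha>)"
    using assms(2) by (auto simp: seg_solution_def)
  have "x = 0" if x: "x \<in> visited_by N xs \<alpha>" for x
  proof -
    obtain i where "i < length xs" "x = xs ! i" "arrival N xs i \<le> \<alpha>"
      using x by (auto simp: visited_by_def)
    with travel_le_arrival[OF xs(1)] have "travel N (source N) x \<le> \<alpha>" by force
    then show ?thesis using \<open>\<not> 1 \<le> \<alpha>\<close> by (simp add: N_def split: if_splits)
  qed
  then have "card (visited_by N xs \<alpha>) \<le> card {0::nat}" by (intro card_mono) auto
  with xs(2) show False by simp
qed

text \<open>One \<open>c\<close> is both coefficient and exponent, as in the definitions of strongly
  polynomial bounds. The value at 0 is excluded, since \<open>x ^ c\<close> vanishes there for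
  positive \<open>c\<close>.\<close>

definition poly_bounded :: "(nat \<Rightarrow> nat) \<Rightarrow> bool" where
  "poly_bounded f \<longleftrightarrow> (\<exists>c. \<forall>x\<ge>1. f x \<le> c * x ^ c)"

lemma poly_bounded_const: "poly_bounded (\<lambda>x. a)"
  unfolding poly_bounded_def by (rule exI[of _ a]) simp

lemma poly_bounded_ident: "poly_bounded (\<lambda>x. x)"
  unfolding poly_bounded_def by (rule exI[of _ 1]) simp

lemma poly_bounded_add:
  assumes "poly_bounded f" "poly_bounded g"
  shows "poly_bounded (\<lambda>x. f x + g x)"
proof -
  obtain a b where *: "\<And>x. 1 \<le> x \<Longrightarrow> f x \<le> a * x ^ a" "\<And>x. 1 \<le> x \<Longrightarrow> g x \<le> b * x ^ b"
    using assms unfolding poly_bounded_def by blast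
  have "f x + g x \<le> (a + b) * x ^ (a + b)" if "1 \<le> x" for x
  proof -
    have "a * x ^ a \<le> a * x ^ (a + b)" "b * x ^ b \<le> b * x ^ (a + b)"
      using that by (intro mult_le_mono2 power_increasing; simp)+
    with *[OF that] show ?thesis unfolding add_mult_distrib by linarith
  qed
  then show ?thesis unfolding poly_bounded_def by blast
qed

lemma poly_bounded_mult:
  assumes "poly_bounded f" "poly_bounded g"
  shows "poly_bounded (\<lambda>x. f x * g x)"
proof -
  obtain a b where *: "\<And>x. 1 \<le> x \<Longrightarrow> f x \<le> a * x ^ a" "\<And>x. 1 \<le> x \<Longrightarrow> g x \<le> b * x ^ b"
    using assms unfolding poly_bounded_def by blast
  let ?c = "a * b + a + b"
  have "f x * g x \<le> ?c * x ^ ?c" if "1 \<le> x" for x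
  proof -
    have "f x * g x \<le> (a * x ^ a) * (b * x ^ b)" using *[OF that] by (rule mult_le_mono)
    also have "\<dots> = (a * b) * x ^ (a + b)" by (simp add: power_add ac_simps)
    also have "\<dots> \<le> ?c * x ^ ?c" using that by (intro mult_le_mono power_increasing) simp_all
    finally show ?thesis .
  qed
  then show ?thesis unfolding poly_bounded_def by blast
qed

lemma poly_bounded_power: "poly_bounded f \<Longrightarrow> poly_bounded (\<lambda>x. f x ^ e)"
  by (induction e) (simp_all add: poly_bounded_const poly_bounded_mult)

theorem theorem1:
  fixes p :: real
  assumes "p \<ge> 1"
  shows "\<exists>C::real. \<forall>\<epsilon>::real. \<epsilon> > 0 \<longrightarrow>
    (\<exists>k::nat. real k \<le> C * (1 + 1 / \<epsilon>\<^sup>2) \<and>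
      (\<forall>(\<alpha>::real) A. seg_approx_algorithm \<alpha> k A \<longrightarrow>
        (\<exists>P. lp_approx_algorithm p k A ((1 + \<epsilon>) * \<alpha>) P \<and>
             strongly_polynomial_calls p k A P \<and>
             strongly_polynomial_time p k A P)))"
proof -
  \<comment> \<open>Depends on \<open>p\<close> only, so it may enter \<open>C\<close>, which is
    fixed before \<open>\<epsilon>\<close>.\<close>
  define c where "c = nat \<lceil>2 * 19 powr p\<rceil>"
  have c: "2 * 19 powr p \<le> real c" unfolding c_def by linarith
  show ?thesis
  proof (intro exI[of _ "18 * real c + 2"] allI impI)
    fix \<epsilon> :: real
    assume \<epsilon>: "\<epsilon> > 0"
    \<comment> \<open>This makes the loss \<open>3 / h\<close> at most
      \<open>\<epsilon>\<close>.\<close>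
    define h where "h = nat \<lceil>3 / \<epsilon>\<rceil>"
    have "0 < 3 / \<epsilon>" using \<epsilon> by simp
    then have h: "0 < h" "3 / \<epsilon> \<le> real h" "real h \<le> 3 / \<epsilon> + 1" unfolding h_def by linarith+
    define k where "k = c * h\<^sup>2"
    define K where "K = k + 2"
    define M where "M = (h + 1) * 2 ^ k"
    have k: "2 * 19 powr p * (real h)\<^sup>2 \<le> real k"
      unfolding k_def using mult_right_mono[OF c, of "(real h)\<^sup>2"] by simp
    show "\<exists>k. real k \<le> (18 * real c + 2) * (1 + 1 / \<epsilon>\<^sup>2) \<and>
      (\<forall>(\<alpha>::real) A. seg_approx_algorithm \<alpha> k A \<longrightarrow>
        (\<exists>P. lp_approx_algorithm p k A ((1 + \<epsilon>) * \<alpha>) P \<and>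
             strongly_polynomial_calls p k A P \<and> strongly_polynomial_time p k A P))"
    proof (intro exI[of _ K] conjI allI impI)
      have "(real h)\<^sup>2 \<le> (3 / \<epsilon> + 1)\<^sup>2" using h(3) by (intro power_mono) simp_all
      \<comment> \<open>From \<open>(u - 1) ^ 2 \<ge> 0\<close> with
        \<open>u = 3 / \<epsilon>\<close>. Here the 18 of \<open>C\<close> arises; its 2 pays for
        the two deadlines beyond \<open>k\<close>.\<close>
      also have "\<dots> \<le> 2 * (3 / \<epsilon>)\<^sup>2 + 2"
        using zero_le_power2[of "3 / \<epsilon> - 1"] by (simp add: power2_eq_square algebra_simps)
      also have "\<dots> \<le> 18 * (1 + 1 / \<epsilon>\<^sup>2)" by (simp add: power_divide)
      finally have "real c * (real h)\<^sup>2 \<le> real c * (18 * (1 + 1 / \<epsilon>\<^sup>2))" by (intro mult_left_mono) simp_all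
      moreover have "(18 * real c + 2) * (1 + 1 / \<epsilon>\<^sup>2) = real c * (18 * (1 + 1 / \<epsilon>\<^sup>2)) + 2 + 2 / \<epsilon>\<^sup>2"
        by (simp add: algebra_simps)
      moreover have "0 \<le> 2 / \<epsilon>\<^sup>2" "real K = real c * (real h)\<^sup>2 + 2" by (simp_all add: K_def k_def)
      ultimately show "real K \<le> (18 * real c + 2) * (1 + 1 / \<epsilon>\<^sup>2)" by linarith
    next
      fix \<alpha> :: real and A
      assume seg: "seg_approx_algorithm \<alpha> K A"
      then have \<alpha>: "1 \<le> \<alpha>" by (rule seg_approx_algorithm_ge_1) (simp add: K_def)
      \<comment> \<open>The real number \<open>\<alpha>\<close> cannot be a literal of the program,
        an integer can.\<close>
      define \<beta> where "\<beta> = nat \<lceil>8 * \<alpha>\<rceil>"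
      have \<beta>: "8 * \<alpha> \<le> real \<beta>" "real \<beta> \<le> 9 * \<alpha>" unfolding \<beta>_def using \<alpha> by linarith+
      let ?P = "lp_program K h M \<beta>"
      define I where "I x = x * (M * (x + 1)) ^ (K + 4)" for x
      define T where "T x = (I x + 1) * (4 * I x + 3 * x + 5 * K + 41) + 15 + (4 * x + 12) * x" for x
      have run: "\<exists>t m rs. exec p K A N ?P (initial_state N) t m rs \<and> feasible_route N (result N t) \<and>
          lp_objective p N (result N t) \<le> (1 + \<epsilon>) * \<alpha> * lp_opt p N \<and> length rs \<le> I (nverts N) \<and>
          m \<le> T (nverts N + sum_list (map length rs))"
        if N: "metric_network N" for N
      proof -
        interpret reduction p K A N h M \<beta> k \<alpha>
          by unfold_locales (use N assms seg \<alpha> \<beta> k h(1) in \<open>simp_all add: K_def M_def\<close>)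
        have I: "iteration_count = I n" by (simp add: iteration_count_def I_def base_def)
        have "3 / real h \<le> \<epsilon>" using h(1,2) \<epsilon> by (simp add: field_simps)
        moreover have "0 \<le> lp_opt p N" using lp_opt_attained[of p] by (metis lp_objective_def powr_ge_zero)
        ultimately have opt: "(1 + 3 / real h) * \<alpha> * lp_opt p N \<le> (1 + \<epsilon>) * \<alpha> * lp_opt p N"
          using \<alpha> by (intro mult_right_mono) simp_all
        obtain t m rs where run: "exec p K A N ?P (initial_state N) t m rs"
          and post: "feasible_route N (result N t) \<and>
            lp_objective p N (result N t) \<le> (1 + 3 / real h) * \<alpha> * lp_opt p N \<and> length rs \<le> I n \<and>
            m \<le> (I n + 1) * (4 * I n + 3 * n + 5 * K + 41) + 15 + (4 * n + 12) * answered rs"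
          by (rule wpE[OF wp_lp_program_approx[unfolded I]])
        have "I n \<le> I (n + answered rs)"
          unfolding I_def by (intro mult_le_mono power_mono) simp_all
        then have "(I n + 1) * (4 * I n + 3 * n + 5 * K + 41) + 15 + (4 * n + 12) * answered rs
            \<le> T (n + answered rs)"
          unfolding T_def by (intro add_mono mult_le_mono) simp_all
        with post opt have "lp_objective p N (result N t) \<le> (1 + \<epsilon>) * \<alpha> * lp_opt p N"
          "m \<le> T (n + answered rs)" by linarith+
        with run post show ?thesis by blast
      qed
      have poly_I: "poly_bounded I"
        unfolding I_def
        by (intro poly_bounded_mult poly_bounded_add poly_bounded_power poly_bounded_ident poly_bounded_const)
      have poly_T: "poly_bounded T"
        unfolding T_def
        by (intro poly_bounded_mult poly_bounded_add poly_bounded_ident poly_bounded_const poly_I)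
      have nverts: "1 \<le> nverts N" if "metric_network N" for N
        using that by (auto simp: metric_network_def verts_def)
      show "\<exists>P. lp_approx_algorithm p K A ((1 + \<epsilon>) * \<alpha>) P \<and>
             strongly_polynomial_calls p K A P \<and> strongly_polynomial_time p K A P"
      proof (intro exI[of _ ?P] conjI)
        show "lp_approx_algorithm p K A ((1 + \<epsilon>) * \<alpha>) ?P"
          unfolding lp_approx_algorithm_def using run by blast
        \<comment> \<open>\<open>run\<close> yields one execution; by determinism its bounds hold
          for every execution.\<close>
        have bounds: "length rs \<le> I (nverts N) \<and> m \<le> T (nverts N + sum_list (map length rs))"
          if "metric_network N" "exec p K A N ?P (initial_state N) t m rs" for N t m rs
          using run[OF that(1)] exec_deterministic[OF that(2)] by blast
        obtain a where "\<And>x. 1 \<le> x \<Longrightarrow> I x \<le> a * x ^ a" using poly_I unfolding poly_bounded_def by blast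
        then show "strongly_polynomial_calls p K A ?P"
          unfolding strongly_polynomial_calls_def using bounds nverts by (meson order_trans)
        obtain b where b: "\<And>x. 1 \<le> x \<Longrightarrow> T x \<le> b * x ^ b" using poly_T unfolding poly_bounded_def by blast
        show "strongly_polynomial_time p K A ?P"
          unfolding strongly_polynomial_time_def
        proof (intro exI[of _ b] allI impI)
          fix N t m rs
          assume N: "metric_network N" "exec p K A N ?P (initial_state N) t m rs"
          have "m \<le> T (nverts N + sum_list (map length rs))" using bounds[OF N] by simp
          also have "\<dots> \<le> b * (nverts N + sum_list (map length rs)) ^ b"
            using nverts[OF N(1)] by (intro b) simp
          finally show "m \<le> b * (nverts N + sum_list (map length rs)) ^ b" .
        qed
      qed
    qed
  qed
qed

end
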